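(* Let $R = \prod_{i \in I} R_i$, where $I$ is a nonempty index set and each $R_i$ is a nonzero unital commutative ring whose total ring of fractions $Q(R_i)$ is Kasch. Define $$\tau(R) = \tau\Big(\prod_{i \in I} R_i\Big) := \min_{i \in I}\ \min_{\mathfrak{m}_i \in \mathrm{MaxSpec}\, Q(R_i)} |R_i/(\mathfrak{m}_i \cap R_i)|$$ (which is possibly infinite). Given an integer $n \geq 3$, the following are equivalent: (1) $R$ is $n$-Vandermonde full. (2) $\tau(R) > n$. (3) If $f : R^n \to R$ is a multi-affine polynomial map and $f|_{R\mathbf{v}}$ is affine-linear for all directions $\mathbf{v} \in R^n$, then $f$ is affine-linear on $R^n$. (3') If $f : R^n \to R$ is a multi-affine polynomial map and $f|_{R\mathbf{v}}$ is affine-linear for all ballot directions $\mathbf{v}$, then $f$ is affine-linear on $R^n$.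
   Context: Total ring of fractions and Kasch rings: for a unital commutative ring $S$, let $ZD(S)$ be its set of zerodivisors ($0$ counts as a zerodivisor), and let $Q(S) := (S \setminus ZD(S))^{-1} S$; the canonical map $S \to Q(S)$ is injective, and for an ideal $\mathfrak{m}$ of $Q(S)$, $\mathfrak{m} \cap S$ denotes its preimage in $S$. A unital commutative ring is Kasch if each of its maximal ideals has nonzero annihilator. $\mathrm{MaxSpec}$ denotes the set of maximal ideals. Vandermonde fullness: let $p_n(\mathbf{x}) := \prod_{j=1}^n x_j \cdot \prod_{1 \leq j < k \leq n} (x_j - x_k) \in R[x_1,\dots,x_n]$, and let $I_{p_n} = I_{p_n}(R)$ be the ideal of $R$ generated by $\{p_n(\mathbf{r}) : \mathbf{r} \in R^n\}$. The ring $R$ is $n$-Vandermonde full if $\mathrm{Ann}_R(I_{p_n}) = 0$. Multi-affine and affine-linear: a map $f : R^n \to R$ is a multi-affine polynomial map if there are scalars $a_J \in R$ ($J \subseteq [n] := \{1,\dots,n\}$) with $f(\mathbf{x}) = \sum_{J \subseteq [n]} a_J \prod_{j \in J} x_j$ for all $\mathbf{x} \in R^n$. For $\mathbf{v} \in R^n$, $f|_{R\mathbf{v}}$ is affine-linear if there is $m_{\mathbf{v}} \in R$ with $f(r\mathbf{v}) = f(0) + r\, m_{\mathbf{v}}$ for all $r \in R$. The map $f$ is affine-linear on $R^n$ if there are $a_1,\dots,a_n \in R$ with $f(c_1,\dots,c_n) = f(0) + \sum_{i=1}^n a_i c_i$ for all $c_1,\dots,c_n \in R$. Ballot directions: a set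 $B = \{x_1 < \cdots < x_k\} \subseteq [n]$ is a ballot set if $x_i \geq 2i$ for all $1 \leq i \leq k$ (the empty set is ballot). The ballot directions are the vectors $\mathbf{v} \in \{0,1\}^n$ (regarded in $R^n$) whose support $\{j : v_j = 1\}$ is $[n] \setminus B$ for some ballot set $B \subseteq [n]$. *)

theory Defs
  imports "HOL-Algebra.Algebra" "HOL-Library.Extended_Nat"
begin

section \<open>Products of families of rings\<close>

definition product_ring :: "'i set \<Rightarrow> ('i \<Rightarrow> ('a, 'm) ring_scheme) \<Rightarrow> ('i \<Rightarrow> 'a) ring" where
  "product_ring I R =
     \<lparr>carrier = (\<Pi>\<^sub>E i\<in>I. carrier (R i)),
      monoid.mult = (\<lambda>x y. \<lambda>i\<in>I. x i \<otimes>\<^bsub>R i\<^esub> y i),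
      monoid.one = (\<lambda>i\<in>I. \<one>\<^bsub>R i\<^esub>),
      ring.zero = (\<lambda>i\<in>I. \<zero>\<^bsub>R i\<^esub>),
      ring.add = (\<lambda>x y. \<lambda>i\<in>I. x i \<oplus>\<^bsub>R i\<^esub> y i)\<rparr>"

lemma cring_product_ring:
  assumes "\<And>i. i \<in> I \<Longrightarrow> cring (R i)"
  shows "cring (product_ring I R)"
proof -
  note ring = cring.cring_simprules[OF assms]
  have add_comm: "a \<oplus>\<^bsub>R i\<^esub> b = b \<oplus>\<^bsub>R i\<^esub> a"
    if "i \<in> I" "a \<in> carrier (R i)" "b \<in> carrier (R i)" for i a b
    using that by (rule ring(10))
  have one: "a \<otimes>\<^bsub>R i\<^esub> \<one>\<^bsub>R i\<^esub> = a" if "i \<in> I" "a \<in> carrier (R i)" for i a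
    using that ring by metis
  have mult_comm: "a \<otimes>\<^bsub>R i\<^esub> b = b \<otimes>\<^bsub>R i\<^esub> a"
    if "i \<in> I" "a \<in> carrier (R i)" "b \<in> carrier (R i)" for i a b
    using that by (rule ring(14))
  show ?thesis
  proof (rule cringI)
    show "abelian_group (product_ring I R)"
    proof (rule abelian_groupI)
      fix x assume x: "x \<in> carrier (product_ring I R)"
      show "\<exists>y\<in>carrier (product_ring I R).
              y \<oplus>\<^bsub>product_ring I R\<^esub> x = \<zero>\<^bsub>product_ring I R\<^esub>"
        by (rule bexI[where x = "\<lambda>i\<in>I. \<ominus>\<^bsub>R i\<^esub> x i"])
           (use x in \<open>auto simp: product_ring_def PiE_iff fun_eq_iff ring\<close>)
    qed (auto simp: product_ring_def PiE_iff fun_eq_iff extensional_def ring intro: add_comm)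
    show "comm_monoid (product_ring I R)"
      by (rule comm_monoidI)
         (auto simp: product_ring_def PiE_iff fun_eq_iff extensional_def ring one intro: mult_comm)
  qed (auto simp: product_ring_def PiE_iff fun_eq_iff ring)
qed


section \<open>Rings of fractions\<close>

definition zero_divisors :: "('a, 'm) ring_scheme \<Rightarrow> 'a set" where
  "zero_divisors S =
     {a \<in> carrier S. a = \<zero>\<^bsub>S\<^esub> \<or> (\<exists>b\<in>carrier S. b \<noteq> \<zero>\<^bsub>S\<^esub> \<and> a \<otimes>\<^bsub>S\<^esub> b = \<zero>\<^bsub>S\<^esub>)}"

definition frac_rel :: "'a set \<Rightarrow> ('a, 'm) ring_scheme \<Rightarrow> (('a \<times> 'a) \<times> ('a \<times> 'a)) set" where
  "frac_rel M S =
     {((a, s), (b, t)). a \<in> carrier S \<and> s \<in> M \<and> b \<in> carrier S \<and> t \<in> M \<and>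
        (\<exists>u\<in>M. u \<otimes>\<^bsub>S\<^esub> (a \<otimes>\<^bsub>S\<^esub> t \<ominus>\<^bsub>S\<^esub> b \<otimes>\<^bsub>S\<^esub> s) = \<zero>\<^bsub>S\<^esub>)}"

definition fraction :: "'a set \<Rightarrow> ('a, 'm) ring_scheme \<Rightarrow> 'a \<Rightarrow> 'a \<Rightarrow> ('a \<times> 'a) set" where
  "fraction M S a s = frac_rel M S `` {(a, s)}"

definition localization :: "'a set \<Rightarrow> ('a, 'm) ring_scheme \<Rightarrow> ('a \<times> 'a) set ring" where
  "localization M S =
     \<lparr>carrier = (carrier S \<times> M) // frac_rel M S,
      monoid.mult = (\<lambda>A B. \<Union>(a, s)\<in>A. \<Union>(b, t)\<in>B. fraction M S (a \<otimes>\<^bsub>S\<^esub> b) (s \<otimes>\<^bsub>S\<^esub> t)),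
      monoid.one = fraction M S \<one>\<^bsub>S\<^esub> \<one>\<^bsub>S\<^esub>,
      ring.zero = fraction M S \<zero>\<^bsub>S\<^esub> \<one>\<^bsub>S\<^esub>,
      ring.add = (\<lambda>A B. \<Union>(a, s)\<in>A. \<Union>(b, t)\<in>B.
               fraction M S (a \<otimes>\<^bsub>S\<^esub> t \<oplus>\<^bsub>S\<^esub> b \<otimes>\<^bsub>S\<^esub> s) (s \<otimes>\<^bsub>S\<^esub> t))\<rparr>"

definition total_fractions :: "('a, 'm) ring_scheme \<Rightarrow> ('a \<times> 'a) set ring" where
  "total_fractions S = localization (carrier S - zero_divisors S) S"

definition to_total_fractions :: "('a, 'm) ring_scheme \<Rightarrow> 'a \<Rightarrow> ('a \<times> 'a) set" where
  "to_total_fractions S a = fraction (carrier S - zero_divisors S) S a \<one>\<^bsub>S\<^esub>"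

definition contraction :: "('a, 'm) ring_scheme \<Rightarrow> ('a \<times> 'a) set set \<Rightarrow> 'a set" where
  "contraction S \<mm> = {a \<in> carrier S. to_total_fractions S a \<in> \<mm>}"

context cring
begin

lemma mult_minus_distr:
  "x \<in> carrier R \<Longrightarrow> y \<in> carrier R \<Longrightarrow> z \<in> carrier R \<Longrightarrow> x \<otimes> (y \<ominus> z) = x \<otimes> y \<ominus> x \<otimes> z"
  by algebra

lemma minus_add_minus_cancel:
  "x \<in> carrier R \<Longrightarrow> y \<in> carrier R \<Longrightarrow> z \<in> carrier R \<Longrightarrow> (x \<ominus> y) \<oplus> (y \<ominus> z) = x \<ominus> z"
  by algebra

lemma frac_rel_trans:
  assumes M: "submonoid M R"
    and c: "a \<in> carrier R" "b \<in> carrier R" "c \<in> carrier R" "s \<in> M" "t \<in> M" "r \<in> M" "u \<in> M" "v \<in> M"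
    and 1: "u \<otimes> (a \<otimes> t \<ominus> b \<otimes> s) = \<zero>" and 2: "v \<otimes> (b \<otimes> r \<ominus> c \<otimes> t) = \<zero>"
  shows "\<exists>w\<in>M. w \<otimes> (a \<otimes> r \<ominus> c \<otimes> s) = \<zero>"
proof
  note sub = submonoid.mem_carrier[OF M]
  show "u \<otimes> v \<otimes> t \<in> M"
    using c by (simp add: submonoid.m_closed[OF M])
  have "u \<otimes> v \<otimes> t \<otimes> (a \<otimes> r \<ominus> c \<otimes> s) =
        v \<otimes> r \<otimes> (u \<otimes> (a \<otimes> t \<ominus> b \<otimes> s)) \<oplus> u \<otimes> s \<otimes> (v \<otimes> (b \<otimes> r \<ominus> c \<otimes> t))"
    using c sub by (simp add: mult_minus_distr m_ac minus_add_minus_cancel)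
  also have "\<dots> = \<zero>"
    unfolding 1 2 using c sub by simp
  finally show "u \<otimes> v \<otimes> t \<otimes> (a \<otimes> r \<ominus> c \<otimes> s) = \<zero>" .
qed

lemma equiv_frac_rel:
  assumes M: "submonoid M R"
  shows "equiv (carrier R \<times> M) (frac_rel M R)"
proof (rule equivI)
  note sub = submonoid.mem_carrier[OF M]
  show "frac_rel M R \<subseteq> (carrier R \<times> M) \<times> (carrier R \<times> M)"
    by (auto simp: frac_rel_def)
  show "refl_on (carrier R \<times> M) (frac_rel M R)"
    by (auto simp: frac_rel_def refl_on_def r_right_minus_eq sub
             intro!: bexI[of _ \<one>] submonoid.one_closed[OF M])
  show "sym (frac_rel M R)"
  proof (rule symI, clarsimp simp: frac_rel_def)
    fix a s b t u
    assume *: "a \<in> carrier R" "s \<in> M" "b \<in> carrier R" "t \<in> M" "u \<in> M"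
      "u \<otimes> (a \<otimes> t \<ominus> b \<otimes> s) = \<zero>"
    have "u \<otimes> (b \<otimes> s \<ominus> a \<otimes> t) = \<ominus> (u \<otimes> (a \<otimes> t \<ominus> b \<otimes> s))"
      using *(1-5) by (auto dest!: sub) algebra
    then show "\<exists>u\<in>M. u \<otimes> (b \<otimes> s \<ominus> a \<otimes> t) = \<zero>"
      using * by auto
  qed
  show "trans (frac_rel M R)"
    by (rule transI) (auto simp: frac_rel_def intro: frac_rel_trans[OF M])
qed

lemma fraction_eq_iff:
  assumes "submonoid M R" "a \<in> carrier R" "s \<in> M" "b \<in> carrier R" "t \<in> M"
  shows "fraction M R a s = fraction M R b t \<longleftrightarrow> (\<exists>u\<in>M. u \<otimes> (a \<otimes> t \<ominus> b \<otimes> s) = \<zero>)"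
  unfolding fraction_def using assms
  by (subst eq_equiv_class_iff[OF equiv_frac_rel]) (auto simp: frac_rel_def)

lemma fraction_eqI:
  assumes M: "submonoid M R" and c: "a \<in> carrier R" "s \<in> M" "b \<in> carrier R" "t \<in> M"
    and "a \<otimes> t = b \<otimes> s"
  shows "fraction M R a s = fraction M R b t"
  using assms by (subst fraction_eq_iff)
    (auto simp: r_right_minus_eq submonoid.mem_carrier[OF M]
          intro!: bexI[of _ \<one>] submonoid.one_closed[OF M])

lemma carrier_localization:
  "carrier (localization M R) = {fraction M R a s | a s. a \<in> carrier R \<and> s \<in> M}"
  by (auto simp: localization_def quotient_def fraction_def)

lemma one_localization: "\<one>\<^bsub>localization M R\<^esub> = fraction M R \<one> \<one>"
  and zero_localization: "\<zero>\<^bsub>localization M R\<^esub> = fraction M R \<zero> \<one>"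
  by (simp_all add: localization_def)

lemma mult_localization:
  assumes M: "submonoid M R" and c: "a \<in> carrier R" "s \<in> M" "b \<in> carrier R" "t \<in> M"
  shows "fraction M R a s \<otimes>\<^bsub>localization M R\<^esub> fraction M R b t = fraction M R (a \<otimes> b) (s \<otimes> t)"
proof -
  note sub = submonoid.mem_carrier[OF M]
  note eq = equiv_frac_rel[OF M]
  have "(\<lambda>x y. case x of (a, s) \<Rightarrow> case y of (b, t) \<Rightarrow> fraction M R (a \<otimes> b) (s \<otimes> t))
          respects2 frac_rel M R"
  proof (rule congruent2_commuteI[OF eq])
    fix x y assume "x \<in> carrier R \<times> M" "y \<in> carrier R \<times> M"
    then show "(case x of (a, s) \<Rightarrow> case y of (b, t) \<Rightarrow> fraction M R (a \<otimes> b) (s \<otimes> t)) =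
               (case y of (a, s) \<Rightarrow> case x of (b, t) \<Rightarrow> fraction M R (a \<otimes> b) (s \<otimes> t))"
      by (auto simp: m_comm sub)
  next
    fix x y z assume "z \<in> carrier R \<times> M" "(x, y) \<in> frac_rel M R"
    then obtain a s b t c r u where *: "x = (a, s)" "y = (b, t)" "z = (c, r)"
      "a \<in> carrier R" "s \<in> M" "b \<in> carrier R" "t \<in> M" "c \<in> carrier R" "r \<in> M" "u \<in> M"
      "u \<otimes> (a \<otimes> t \<ominus> b \<otimes> s) = \<zero>"
      by (auto simp: frac_rel_def)
    have "u \<otimes> (c \<otimes> a \<otimes> (r \<otimes> t) \<ominus> c \<otimes> b \<otimes> (r \<otimes> s)) =
          c \<otimes> r \<otimes> (u \<otimes> (a \<otimes> t \<ominus> b \<otimes> s))"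
      using *(4-10) sub by (simp add: mult_minus_distr m_ac)
    also have "\<dots> = \<zero>" using * sub by simp
    finally show "(case z of (a, s) \<Rightarrow> case x of (b, t) \<Rightarrow> fraction M R (a \<otimes> b) (s \<otimes> t)) =
                  (case z of (a, s) \<Rightarrow> case y of (b, t) \<Rightarrow> fraction M R (a \<otimes> b) (s \<otimes> t))"
      using * by (auto simp: fraction_eq_iff[OF M] submonoid.m_closed[OF M])
  qed
  from UN_equiv_class2[OF eq eq this, of "(a, s)" "(b, t)"] c show ?thesis
    by (simp add: localization_def fraction_def case_prod_unfold)
qed

lemma add_localization:
  assumes M: "submonoid M R" and c: "a \<in> carrier R" "s \<in> M" "b \<in> carrier R" "t \<in> M"
  shows "fraction M R a s \<oplus>\<^bsub>localization M R\<^esub> fraction M R b t =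
         fraction M R (a \<otimes> t \<oplus> b \<otimes> s) (s \<otimes> t)"
proof -
  note sub = submonoid.mem_carrier[OF M]
  note eq = equiv_frac_rel[OF M]
  have "(\<lambda>x y. case x of (a, s) \<Rightarrow> case y of (b, t) \<Rightarrow> fraction M R (a \<otimes> t \<oplus> b \<otimes> s) (s \<otimes> t))
          respects2 frac_rel M R"
  proof (rule congruent2_commuteI[OF eq])
    fix x y assume "x \<in> carrier R \<times> M" "y \<in> carrier R \<times> M"
    then show "(case x of (a, s) \<Rightarrow> case y of (b, t) \<Rightarrow> fraction M R (a \<otimes> t \<oplus> b \<otimes> s) (s \<otimes> t)) =
               (case y of (a, s) \<Rightarrow> case x of (b, t) \<Rightarrow> fraction M R (a \<otimes> t \<oplus> b \<otimes> s) (s \<otimes> t))"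
      by (auto simp: m_comm a_comm sub)
  next
    fix x y z assume "z \<in> carrier R \<times> M" "(x, y) \<in> frac_rel M R"
    then obtain a s b t c r u where *: "x = (a, s)" "y = (b, t)" "z = (c, r)"
      "a \<in> carrier R" "s \<in> M" "b \<in> carrier R" "t \<in> M" "c \<in> carrier R" "r \<in> M" "u \<in> M"
      "u \<otimes> (a \<otimes> t \<ominus> b \<otimes> s) = \<zero>"
      by (auto simp: frac_rel_def)
    have cancel: "(x \<oplus> y) \<ominus> (x \<oplus> z) = y \<ominus> z"
      if "x \<in> carrier R" "y \<in> carrier R" "z \<in> carrier R" for x y z
      using that by algebra
    have "u \<otimes> ((c \<otimes> s \<oplus> a \<otimes> r) \<otimes> (r \<otimes> t) \<ominus> (c \<otimes> t \<oplus> b \<otimes> r) \<otimes> (r \<otimes> s)) =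
          r \<otimes> r \<otimes> (u \<otimes> (a \<otimes> t \<ominus> b \<otimes> s))"
      using *(4-10) sub by (simp add: mult_minus_distr l_distr r_distr m_ac cancel)
    also have "\<dots> = \<zero>" using * sub by simp
    finally show "(case z of (a, s) \<Rightarrow> case x of (b, t) \<Rightarrow> fraction M R (a \<otimes> t \<oplus> b \<otimes> s) (s \<otimes> t)) =
                  (case z of (a, s) \<Rightarrow> case y of (b, t) \<Rightarrow> fraction M R (a \<otimes> t \<oplus> b \<otimes> s) (s \<otimes> t))"
      using * sub by (auto simp: fraction_eq_iff[OF M] submonoid.m_closed[OF M])
  qed
  from UN_equiv_class2[OF eq eq this, of "(a, s)" "(b, t)"] c show ?thesis
    by (simp add: localization_def fraction_def case_prod_unfold)
qed

lemma cring_localization: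
  assumes M: "submonoid M R"
  shows "cring (localization M R)"
proof -
  note sub = submonoid.mem_carrier[OF M]
  note [simp] = submonoid.m_closed[OF M] submonoid.one_closed[OF M]
  note ops = mult_localization[OF M] add_localization[OF M] one_localization zero_localization
  have closed: "fraction M R a s \<in> carrier (localization M R)" if "a \<in> carrier R" "s \<in> M" for a s
    using that by (auto simp: carrier_localization)
  have elim: thesis
    if "A \<in> carrier (localization M R)"
      "\<And>a s. A = fraction M R a s \<Longrightarrow> a \<in> carrier R \<Longrightarrow> s \<in> M \<Longrightarrow> s \<in> carrier R \<Longrightarrow> thesis" for A thesis
    using that sub by (auto simp: carrier_localization)
  show ?thesis
  proof (rule cringI)
    show "abelian_group (localization M R)"
    proof (rule abelian_groupI)
      fix A assume "A \<in> carrier (localization M R)"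
      then show "\<exists>B\<in>carrier (localization M R).
                   B \<oplus>\<^bsub>localization M R\<^esub> A = \<zero>\<^bsub>localization M R\<^esub>"
      proof (rule elim)
        fix a s assume *: "A = fraction M R a s" "a \<in> carrier R" "s \<in> M" "s \<in> carrier R"
        have "fraction M R (\<ominus> a) s \<oplus>\<^bsub>localization M R\<^esub> A = \<zero>\<^bsub>localization M R\<^esub>"
          using * by (simp add: ops l_minus l_neg) (rule fraction_eqI[OF M]; simp)
        moreover have "fraction M R (\<ominus> a) s \<in> carrier (localization M R)"
          using * by (intro closed) simp_all
        ultimately show ?thesis ..
      qed
    next
      fix A B C
      assume "A \<in> carrier (localization M R)" "B \<in> carrier (localization M R)"
        "C \<in> carrier (localization M R)"
      then obtain a s b t c r where *: "A = fraction M R a s" "B = fraction M R b t" "C = fraction M R c r"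
        "a \<in> carrier R" "s \<in> M" "b \<in> carrier R" "t \<in> M" "c \<in> carrier R" "r \<in> M"
        by (auto simp: carrier_localization)
      have carr: "a \<in> carrier R" "s \<in> carrier R" "b \<in> carrier R" "t \<in> carrier R"
        "c \<in> carrier R" "r \<in> carrier R"
        using *(4-9) sub by blast+
      have num: "(a \<otimes> t \<oplus> b \<otimes> s) \<otimes> r \<oplus> c \<otimes> (s \<otimes> t) =
            a \<otimes> (t \<otimes> r) \<oplus> (b \<otimes> r \<oplus> c \<otimes> t) \<otimes> s"
        using carr by (simp add: l_distr r_distr m_ac a_assoc)
      show "A \<oplus>\<^bsub>localization M R\<^esub> B \<oplus>\<^bsub>localization M R\<^esub> C =
            A \<oplus>\<^bsub>localization M R\<^esub> (B \<oplus>\<^bsub>localization M R\<^esub> C)"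
        unfolding *(1-3) using *(4-9) carr by (simp add: ops num m_assoc)
    next
      fix A B
      assume "A \<in> carrier (localization M R)" "B \<in> carrier (localization M R)"
      then obtain a s b t where *: "A = fraction M R a s" "B = fraction M R b t"
        "a \<in> carrier R" "s \<in> M" "b \<in> carrier R" "t \<in> M"
        by (auto simp: carrier_localization)
      have carr: "s \<in> carrier R" "t \<in> carrier R"
        using *(4,6) sub by blast+
      show "A \<oplus>\<^bsub>localization M R\<^esub> B = B \<oplus>\<^bsub>localization M R\<^esub> A"
        unfolding *(1,2) using *(3-6) carr by (simp add: ops m_comm a_comm)
    qed (auto simp: ops closed elim!: elim)
    show "comm_monoid (localization M R)"
      by (rule comm_monoidI)
         (auto simp: ops closed m_ac elim!: elim)
  next
    fix A B C
    assume "A \<in> carrier (localization M R)" "B \<in> carrier (localization M R)"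
      "C \<in> carrier (localization M R)"
    then obtain a s b t c r where *: "A = fraction M R a s" "B = fraction M R b t" "C = fraction M R c r"
      "a \<in> carrier R" "s \<in> M" "b \<in> carrier R" "t \<in> M" "c \<in> carrier R" "r \<in> M"
      by (auto simp: carrier_localization)
    show "(A \<oplus>\<^bsub>localization M R\<^esub> B) \<otimes>\<^bsub>localization M R\<^esub> C =
          A \<otimes>\<^bsub>localization M R\<^esub> C \<oplus>\<^bsub>localization M R\<^esub> B \<otimes>\<^bsub>localization M R\<^esub> C"
    proof -
      let ?N = "(a \<otimes> t \<oplus> b \<otimes> s) \<otimes> c" and ?D = "s \<otimes> t \<otimes> r"
      have carr: "a \<in> carrier R" "s \<in> carrier R" "b \<in> carrier R" "t \<in> carrier R"
        "c \<in> carrier R" "r \<in> carrier R"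
        using *(4-9) sub by blast+
      have closed: "?N \<in> carrier R" "?D \<in> carrier R" "?D \<in> M"
        using carr *(4-9) by simp_all
      have N: "a \<otimes> c \<otimes> (t \<otimes> r) \<oplus> b \<otimes> c \<otimes> (s \<otimes> r) = ?N \<otimes> r"
        using carr by (simp add: l_distr r_distr m_ac)
      have D: "s \<otimes> r \<otimes> (t \<otimes> r) = ?D \<otimes> r"
        using carr by (simp add: m_ac)
      have eq: "x \<otimes> (d \<otimes> r) = x \<otimes> r \<otimes> d" if "x \<in> carrier R" "d \<in> carrier R" for x d
        using that carr by (simp add: m_ac)
      have "fraction M R ?N ?D = fraction M R (?N \<otimes> r) (?D \<otimes> r)"
        using closed carr *(9) by (intro fraction_eqI[OF M] eq) simp_all
      then show ?thesis
        unfolding *(1-3) using *(4-9) carr by (simp add: ops N D)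
    qed
  qed
qed

lemma submonoid_regular:
  assumes "\<one> \<noteq> \<zero>"
  shows "submonoid (carrier R - zero_divisors R) R"
proof
  show "x \<otimes> y \<in> carrier R - zero_divisors R"
    if "x \<in> carrier R - zero_divisors R" "y \<in> carrier R - zero_divisors R" for x y
    using that unfolding zero_divisors_def
    by simp (metis m_assoc m_closed)
qed (use assms in \<open>auto simp: zero_divisors_def\<close>)

lemma cring_total_fractions: "\<one> \<noteq> \<zero> \<Longrightarrow> cring (total_fractions R)"
  unfolding total_fractions_def by (intro cring_localization submonoid_regular)

lemma to_total_fractions_hom:
  assumes "\<one> \<noteq> \<zero>"
  shows "to_total_fractions R \<in> ring_hom R (total_fractions R)"
proof -
  note M = submonoid_regular[OF assms]
  show ?thesis
    unfolding to_total_fractions_def total_fractions_def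
    using submonoid.one_closed[OF M]
    by (intro ring_hom_memI)
       (auto simp: mult_localization[OF M] add_localization[OF M] one_localization
         carrier_localization)
qed

lemma inj_on_to_total_fractions:
  assumes "\<one> \<noteq> \<zero>"
  shows "inj_on (to_total_fractions R) (carrier R)"
proof (rule inj_onI)
  note M = submonoid_regular[OF assms]
  fix a b assume ab: "a \<in> carrier R" "b \<in> carrier R"
    and "to_total_fractions R a = to_total_fractions R b"
  then obtain u where "u \<in> carrier R - zero_divisors R" "u \<otimes> (a \<ominus> b) = \<zero>"
    using submonoid.one_closed[OF M]
    by (auto simp: to_total_fractions_def fraction_eq_iff[OF M])
  then have "a \<ominus> b = \<zero>"
    using ab minus_closed[OF ab] unfolding zero_divisors_def by blast
  then show "a = b"
    using ab by (simp add: r_right_minus_eq)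
qed

end


section \<open>Kasch rings\<close>

definition max_spec :: "('a, 'm) ring_scheme \<Rightarrow> 'a set set" where
  "max_spec S = {\<mm>. maximalideal \<mm> S}"

definition annihilator :: "('a, 'm) ring_scheme \<Rightarrow> 'a set \<Rightarrow> 'a set" where
  "annihilator S A = {x \<in> carrier S. \<forall>a\<in>A. x \<otimes>\<^bsub>S\<^esub> a = \<zero>\<^bsub>S\<^esub>}"

definition kasch :: "('a, 'm) ring_scheme \<Rightarrow> bool" where
  "kasch S \<longleftrightarrow> cring S \<and> (\<forall>\<mm>\<in>max_spec S. annihilator S \<mm> \<noteq> {\<zero>\<^bsub>S\<^esub>})"


section \<open>The invariant \<open>\<tau>\<close>\<close>

definition ecard :: "'a set \<Rightarrow> enat" where
  "ecard A = (if finite A then enat (card A) else \<infinity>)"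

text \<open>
  \<^typ>\<open>enat\<close> is well-ordered, so an infimum over a nonempty family is a minimum. The value depends
  on the factors of the product, not only on the product ring; infinite cardinalities are all
  identified with \<^term>\<open>\<infinity>\<close>.
\<close>

definition tau :: "'i set \<Rightarrow> ('i \<Rightarrow> ('a, 'm) ring_scheme) \<Rightarrow> enat" where
  "tau I R = (INF i\<in>I. INF \<mm>\<in>max_spec (total_fractions (R i)).
                ecard (carrier (R i Quot contraction (R i) \<mm>)))"


section \<open>Vectors and Vandermonde fullness\<close>

text \<open>A vector of length \<open>n\<close> is an extensional function on \<open>{1..n}\<close>.\<close>

definition vecs :: "nat \<Rightarrow> ('a, 'm) ring_scheme \<Rightarrow> (nat \<Rightarrow> 'a) set" where
  "vecs n S = (\<Pi>\<^sub>E j\<in>{1..n}. carrier S)"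

definition zero_vector :: "nat \<Rightarrow> ('a, 'm) ring_scheme \<Rightarrow> nat \<Rightarrow> 'a" where
  "zero_vector n S = (\<lambda>j\<in>{1..n}. \<zero>\<^bsub>S\<^esub>)"

definition scale_vector :: "nat \<Rightarrow> ('a, 'm) ring_scheme \<Rightarrow> 'a \<Rightarrow> (nat \<Rightarrow> 'a) \<Rightarrow> nat \<Rightarrow> 'a" where
  "scale_vector n S r v = (\<lambda>j\<in>{1..n}. r \<otimes>\<^bsub>S\<^esub> v j)"

definition vandermonde_value :: "nat \<Rightarrow> ('a, 'm) ring_scheme \<Rightarrow> (nat \<Rightarrow> 'a) \<Rightarrow> 'a" where
  "vandermonde_value n S x =
     (\<Otimes>\<^bsub>S\<^esub>j\<in>{1..n}. x j) \<otimes>\<^bsub>S\<^esub>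
     finprod S (\<lambda>(j, k). x j \<ominus>\<^bsub>S\<^esub> x k) {(j, k). 1 \<le> j \<and> j < k \<and> k \<le> n}"

definition vandermonde_ideal :: "nat \<Rightarrow> ('a, 'm) ring_scheme \<Rightarrow> 'a set" where
  "vandermonde_ideal n S = Idl\<^bsub>S\<^esub> (vandermonde_value n S ` vecs n S)"

definition vandermonde_full :: "nat \<Rightarrow> ('a, 'm) ring_scheme \<Rightarrow> bool" where
  "vandermonde_full n S \<longleftrightarrow> annihilator S (vandermonde_ideal n S) = {\<zero>\<^bsub>S\<^esub>}"


section \<open>Multi-affine and affine-linear maps\<close>

definition multi_affine :: "nat \<Rightarrow> ('a, 'm) ring_scheme \<Rightarrow> ((nat \<Rightarrow> 'a) \<Rightarrow> 'a) \<Rightarrow> bool" where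
  "multi_affine n S f \<longleftrightarrow>
     (\<exists>a\<in>Pow {1..n} \<rightarrow> carrier S. \<forall>x\<in>vecs n S.
        f x = (\<Oplus>\<^bsub>S\<^esub>J\<in>Pow {1..n}. a J \<otimes>\<^bsub>S\<^esub> (\<Otimes>\<^bsub>S\<^esub>j\<in>J. x j)))"

definition affine_linear_along ::
    "nat \<Rightarrow> ('a, 'm) ring_scheme \<Rightarrow> ((nat \<Rightarrow> 'a) \<Rightarrow> 'a) \<Rightarrow> (nat \<Rightarrow> 'a) \<Rightarrow> bool" where
  "affine_linear_along n S f v \<longleftrightarrow>
     (\<exists>m\<in>carrier S. \<forall>r\<in>carrier S.
        f (scale_vector n S r v) = f (zero_vector n S) \<oplus>\<^bsub>S\<^esub> r \<otimes>\<^bsub>S\<^esub> m)"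

definition affine_linear :: "nat \<Rightarrow> ('a, 'm) ring_scheme \<Rightarrow> ((nat \<Rightarrow> 'a) \<Rightarrow> 'a) \<Rightarrow> bool" where
  "affine_linear n S f \<longleftrightarrow>
     (\<exists>a\<in>{1..n} \<rightarrow> carrier S. \<forall>c\<in>vecs n S.
        f c = f (zero_vector n S) \<oplus>\<^bsub>S\<^esub> (\<Oplus>\<^bsub>S\<^esub>i\<in>{1..n}. a i \<otimes>\<^bsub>S\<^esub> c i))"

definition detects_affine_linear ::
    "nat \<Rightarrow> ('a, 'm) ring_scheme \<Rightarrow> (nat \<Rightarrow> 'a) set \<Rightarrow> bool" where
  "detects_affine_linear n S V \<longleftrightarrow>
     (\<forall>f\<in>vecs n S \<rightarrow> carrier S.
        multi_affine n S f \<and> (\<forall>v\<in>V. affine_linear_along n S f v) \<longrightarrow> affine_linear n S f)"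


section \<open>Ballot directions\<close>

text \<open>Lists are indexed from 0, so \<open>x\<^sub>i\<close> is the entry at position \<open>i - 1\<close>.\<close>

definition ballot_set :: "nat \<Rightarrow> nat set \<Rightarrow> bool" where
  "ballot_set n B \<longleftrightarrow>
     B \<subseteq> {1..n} \<and> (\<forall>i\<in>{1..card B}. sorted_list_of_set B ! (i - 1) \<ge> 2 * i)"

definition ballot_directions :: "nat \<Rightarrow> ('a, 'm) ring_scheme \<Rightarrow> (nat \<Rightarrow> 'a) set" where
  "ballot_directions n S =
     {v \<in> \<Pi>\<^sub>E j\<in>{1..n}. {\<zero>\<^bsub>S\<^esub>, \<one>\<^bsub>S\<^esub>}.
        \<exists>B. ballot_set n B \<and> {j \<in> {1..n}. v j = \<one>\<^bsub>S\<^esub>} = {1..n} - B}"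

end

theory Submission
  imports Defs
begin

text \<open>
  All conditions compare polynomial identities on the ring with the vanishing of coefficients.

  From Vandermonde fullness to affine-linearity: restricted to the line in direction \<open>1\<^sub>V\<close>,
  a multi-affine map with coefficients \<open>a J\<close> is a polynomial of degree at most \<open>n\<close>
  in the scalar \<open>r\<close>, whose coefficient of \<open>r\<^sup>k\<close> is the sum of
  \<open>a J\<close> over the \<open>k\<close>-subsets \<open>J\<close> of \<open>V\<close>. If the
  restriction is affine-linear, then a polynomial of degree at most \<open>n\<close> without constant term
  vanishes on the whole ring, and each of its coefficients is killed by all Vandermonde values
  (\<open>difference_product_kills_coefficients\<close>), hence zero. So the sums of \<open>a J\<close> over
  the \<open>k\<close>-subsets disjoint from any ballot set vanish for \<open>k \<ge> 2\<close>. The matrix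
  relating \<open>k\<close>-subsets to small ballot sets by disjointness is square and invertible over the
  integers (\<open>ballot_sums_determine\<close>), so all \<open>a J\<close> with
  \<open>card J \<ge> 2\<close> vanish. This works over every nonzero commutative ring. Ballot directions are
  among all directions, so the condition on ballot directions implies the one on all directions.

  From affine-linearity to \<open>\<tau> > n\<close>: if some residue ring \<open>R i / P\<close> has
  \<open>q \<le> n\<close> elements, it is the field with \<open>q\<close> elements, and the Kasch property
  yields a nonzero \<open>b\<close> with \<open>b P = 0\<close>, hence \<open>b r\<^sup>q = b r\<close> for
  all \<open>r\<close>. The map \<open>b x\<^sub>1 \<cdots> x\<^sub>q\<close> is then linear along every
  direction without being affine-linear (\<open>not_detects_affine_linear_product\<close>).

  From \<open>\<tau> > n\<close> to Vandermonde fullness: the annihilator of a nonzero element of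
  \<open>R i\<close> lies in the contraction \<open>P\<close> of a maximal ideal of the total ring of
  fractions. The domain \<open>R i / P\<close> has more than \<open>n\<close> elements, hence \<open>n\<close>
  distinct nonzero ones, and these provide a Vandermonde value outside \<open>P\<close>
  (\<open>vandermonde_full_product\<close>).
\<close>

section \<open>Sums over subsets disjoint from ballot sets\<close>

lemma ballot_set_empty [simp]: "ballot_set n {}"
  by (simp add: ballot_set_def)

lemma ballot_set_finite: "ballot_set n B \<Longrightarrow> finite B"
  unfolding ballot_set_def using finite_subset by blast

lemma ballot_set_Suc: "ballot_set n B \<Longrightarrow> ballot_set (Suc n) B"
  unfolding ballot_set_def by force

text \<open>
  The ballot condition on the new largest element, which is the entry with index \<open>card B + 1\<close>, is
  the only one to check.
\<close>

lemma ballot_set_insert_Suc: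
  assumes B: "ballot_set n B" and le: "2 * Suc (card B) \<le> Suc n"
  shows "ballot_set (Suc n) (insert (Suc n) B)"
proof -
  have sub: "B \<subseteq> {1..n}" and fin: "finite B"
    using B ballot_set_finite[OF B] by (simp_all add: ballot_set_def)
  have new: "Suc n \<notin> B"
    using sub by auto
  have list: "sorted_list_of_set (insert (Suc n) B) = sorted_list_of_set B @ [Suc n]"
  proof (rule sorted_distinct_set_unique)
    show "sorted (sorted_list_of_set B @ [Suc n])"
      using sub fin by (force simp: sorted_append)
  qed (use fin new in \<open>simp_all add: sorted_insort distinct_insort set_insort_key\<close>)
  have "2 * i \<le> (sorted_list_of_set B @ [Suc n]) ! (i - 1)" if "1 \<le> i" "i \<le> Suc (card B)" for i
  proof (cases "i = Suc (card B)")
    case True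
    then show ?thesis
      using le by (simp add: nth_append)
  next
    case False
    then have i: "i \<in> {1..card B}" and "i - 1 < card B"
      using that by auto
    then have "(sorted_list_of_set B @ [Suc n]) ! (i - 1) = sorted_list_of_set B ! (i - 1)"
      by (simp only: nth_append length_sorted_list_of_set if_True)
    then show ?thesis
      using B i unfolding ballot_set_def by metis
  qed
  moreover have "insert (Suc n) B \<subseteq> {1..Suc n}" "card (insert (Suc n) B) = Suc (card B)"
    using sub fin new by auto
  ultimately show ?thesis
    unfolding ballot_set_def list by simp
qed

lemma ksubsets_Suc:
  assumes "B \<subseteq> {1..n}"
  shows "{J. J \<subseteq> {1..Suc n} - B \<and> card J = Suc k} =
    {J. J \<subseteq> {1..n} - B \<and> card J = Suc k} \<union> insert (Suc n) ` {J. J \<subseteq> {1..n} - B \<and> card J = k}"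
    (is "?L = ?M \<union> insert _ ` ?N")
proof (intro equalityI subsetI)
  fix J assume J: "J \<in> ?L"
  then have fin: "finite J"
    using finite_subset[of J "{1..Suc n} - B"] by auto
  show "J \<in> ?M \<union> insert (Suc n) ` ?N"
  proof (cases "Suc n \<in> J")
    case True
    have "J - {Suc n} \<in> ?N"
      using J True fin by (auto simp: le_Suc_eq)
    moreover have "J = insert (Suc n) (J - {Suc n})"
      using True by auto
    ultimately show ?thesis by blast
  next
    case False
    then show ?thesis
      using J by (auto simp: le_Suc_eq)
  qed
next
  fix J assume "J \<in> ?M \<union> insert (Suc n) ` ?N"
  then show "J \<in> ?L"
  proof
    assume "J \<in> insert (Suc n) ` ?N"
    then obtain K where K: "J = insert (Suc n) K" "K \<subseteq> {1..n} - B" "card K = k"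
      by auto
    then have "finite K" "Suc n \<notin> K"
      using finite_subset[of K "{1..n} - B"] by auto
    then show ?thesis
      using K assms by (auto simp: le_Suc_eq)
  qed auto
qed

text \<open>
  Pascal's rule for sums over \<open>k\<close>-subsets: a subset either avoids the new point or arises from a
  smaller one by adding it.
\<close>

lemma (in abelian_group) finsum_ksubsets_Suc:
  assumes B: "B \<subseteq> {1..n}"
    and a: "\<And>J. J \<subseteq> {1..Suc n} \<Longrightarrow> card J = Suc k \<Longrightarrow> a J \<in> carrier G"
  shows "finsum G a {J. J \<subseteq> {1..Suc n} - B \<and> card J = Suc k} =
    finsum G a {J. J \<subseteq> {1..n} - B \<and> card J = Suc k} \<oplus>
    finsum G (\<lambda>J. a (insert (Suc n) J)) {J. J \<subseteq> {1..n} - B \<and> card J = k}"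
    (is "finsum G a ?L = finsum G a ?M \<oplus> finsum G ?a' ?N")
proof -
  have split: "?L = ?M \<union> insert (Suc n) ` ?N"
    by (rule ksubsets_Suc[OF B])
  have carr: "a \<in> ?L \<rightarrow> carrier G"
    using a by blast
  have inj: "inj_on (insert (Suc n)) ?N"
  proof (rule inj_onI)
    fix J K assume "J \<in> ?N" "K \<in> ?N" "insert (Suc n) J = insert (Suc n) K"
    moreover have "Suc n \<notin> J" "Suc n \<notin> K"
      using calculation by auto
    ultimately show "J = K"
      by (simp add: insert_ident)
  qed
  have carr': "a \<in> ?M \<rightarrow> carrier G" "a \<in> insert (Suc n) ` ?N \<rightarrow> carrier G"
    using carr unfolding split by blast+
  have fin: "finite ?M" "finite ?N"
    by (rule finite_subset[of _ "Pow {1..n}"]; blast)+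
  have "finsum G a ?L = finsum G a ?M \<oplus> finsum G a (insert (Suc n) ` ?N)"
    unfolding split
  proof (rule finsum_Un_disjoint)
    show "?M \<inter> insert (Suc n) ` ?N = {}"
      by auto
  qed (use fin carr' in blast)+
  also have "finsum G a (insert (Suc n) ` ?N) = finsum G ?a' ?N"
    by (rule finsum_reindex[OF carr'(2) inj])
  finally show ?thesis .
qed

text \<open>
  For \<open>k \<le> n\<close> the disjointness matrix behind this lemma is square, because there are exactly
  \<open>n choose min k (n - k)\<close> ballot sets with at most \<open>min k (n - k)\<close> elements; the
  lemma says that it is invertible over every abelian group.

  The proof is by induction on \<open>n\<close>. Write \<open>S B\<close> and \<open>S' B\<close> for the sums
  over the subsets without and with the point \<open>n + 1\<close>. The hypothesis for a ballot set
  \<open>B\<close> of \<open>{1..n}\<close> reads \<open>S B + S' B = 0\<close>. When \<open>B\<close> is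
  smaller than the bound, the hypothesis for \<open>insert (n + 1) B\<close> is also available, and it reads
  \<open>S B = 0\<close>. The bound on \<open>card B\<close> makes both families of smaller sums fall within
  reach of the induction hypothesis, provided that they are treated in the right order.
\<close>

lemma (in abelian_group) ballot_sums_determine:
  assumes "\<And>J. J \<subseteq> {1..n} \<Longrightarrow> card J = k \<Longrightarrow> a J \<in> carrier G"
    and "\<And>B. ballot_set n B \<Longrightarrow> card B \<le> min k (n - k) \<Longrightarrow>
      finsum G a {J. J \<subseteq> {1..n} - B \<and> card J = k} = \<zero>"
    and "J \<subseteq> {1..n}" "card J = k"
  shows "a J = \<zero>"
  using assms
proof (induction n arbitrary: k a J)
  case 0
  then have "a {} \<in> carrier G" "J = {}" "k = 0"
    by auto
  moreover have "{J. J \<subseteq> {1..0::nat} - {} \<and> card J = k} = {{}}"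
    using \<open>k = 0\<close> by auto
  ultimately show ?case
    using "0.prems"(2)[of "{}"] by simp
next
  case (Suc n)
  show ?case
  proof (cases k)
    case 0
    have J: "J = {}"
      using Suc.prems(3,4) 0 finite_subset by fastforce
    have "{J. J \<subseteq> {1..Suc n} - {} \<and> card J = 0} = {{}}"
      using finite_subset[of _ "{1..Suc n}"] by auto
    then show ?thesis
      using Suc.prems(1)[of J] Suc.prems(2)[of "{}"] 0 J by simp
  next
    case (Suc l)
    note k = Suc
    define a' where "a' = (\<lambda>J. a (insert (Suc n) J))"
    have a: "a J \<in> carrier G" if "J \<subseteq> {1..n}" "card J = Suc l" for J
      using that Suc.prems(1)[of J] k by force
    have a': "a' J \<in> carrier G" if "J \<subseteq> {1..n}" "card J = l" for J
    proof -
      have "finite J" "Suc n \<notin> J"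
        using that finite_subset by auto
      then show ?thesis
        unfolding a'_def using that k by (intro Suc.prems(1)) auto
    qed
    define S where "S B = finsum G a {J. J \<subseteq> {1..n} - B \<and> card J = Suc l}" for B
    define S' where "S' B = finsum G a' {J. J \<subseteq> {1..n} - B \<and> card J = l}" for B
    have S: "S B \<in> carrier G" and S': "S' B \<in> carrier G" for B
      unfolding S_def S'_def using a a' by (auto intro!: finsum_closed)
    have plus: "S B \<oplus> S' B = \<zero>" if "ballot_set n B" "card B \<le> min k (Suc n - k)" for B
    proof -
      have "B \<subseteq> {1..n}"
        using that by (simp add: ballot_set_def)
      from finsum_ksubsets_Suc[OF this, of l a] Suc.prems(1) k
      show ?thesis
        using Suc.prems(2)[OF ballot_set_Suc that(2)] that(1) by (simp add: S_def S'_def a'_def)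
    qed
    \<comment> \<open>The new point may be added to \<open>B\<close>: the bound
      \<open>card B + 1 \<le> min k (n + 1 - k)\<close> entails the ballot condition for it.\<close>
    have low: "S B = \<zero>" if B: "ballot_set n B" and le: "Suc (card B) \<le> min k (Suc n - k)" for B
    proof -
      have "B \<subseteq> {1..n}"
        using B by (simp add: ballot_set_def)
      then have "Suc n \<notin> B" and eq: "{1..Suc n} - insert (Suc n) B = {1..n} - B"
        by auto
      then have card: "card (insert (Suc n) B) = Suc (card B)"
        using ballot_set_finite[OF B] by simp
      have "ballot_set (Suc n) (insert (Suc n) B)"
        by (rule ballot_set_insert_Suc[OF B]) (use le in auto)
      from Suc.prems(2)[OF this] show ?thesis
        using le unfolding card eq S_def k by simp
    qed
    have zero: "\<forall>J. J \<subseteq> {1..n} \<and> card J = Suc l \<longrightarrow> a J = \<zero>"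
      if "\<And>B. ballot_set n B \<Longrightarrow> card B \<le> min k (n - k) \<Longrightarrow> S B = \<zero>"
      using Suc.IH[of "Suc l" a] a that unfolding S_def k by blast
    have zero': "\<forall>J. J \<subseteq> {1..n} \<and> card J = l \<longrightarrow> a' J = \<zero>"
      if "\<And>B. ballot_set n B \<Longrightarrow> card B \<le> min l (n - l) \<Longrightarrow> S' B = \<zero>"
      using Suc.IH[of l a'] a' that unfolding S'_def by blast
    have all_zero: "(\<forall>J. J \<subseteq> {1..n} \<and> card J = Suc l \<longrightarrow> a J = \<zero>) \<and>
          (\<forall>J. J \<subseteq> {1..n} \<and> card J = l \<longrightarrow> a' J = \<zero>)"
    proof (cases "k \<le> Suc n - k")
      case True
      \<comment> \<open>Here \<open>min l (n - l) = k - 1\<close>, so the sums \<open>S' B\<close> vanish in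
        the required range; then so do the remaining sums \<open>S B\<close>.\<close>
      have a'0: "\<forall>J. J \<subseteq> {1..n} \<and> card J = l \<longrightarrow> a' J = \<zero>"
      proof (rule zero')
        fix B assume B: "ballot_set n B" "card B \<le> min l (n - l)"
        then have "S B = \<zero>" "S B \<oplus> S' B = \<zero>"
          using True k by (auto intro!: low plus)
        then show "S' B = \<zero>"
          using S' by simp
      qed
      then have S'0: "S' B = \<zero>" for B
        unfolding S'_def by (intro add.finprod_one_eqI) auto
      have "\<forall>J. J \<subseteq> {1..n} \<and> card J = Suc l \<longrightarrow> a J = \<zero>"
      proof (rule zero)
        fix B assume "ballot_set n B" "card B \<le> min k (n - k)"
        then have "S B \<oplus> S' B = \<zero>"
          by (intro plus) auto
        then show "S B = \<zero>"
          using S S'0 by simp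
      qed
      with a'0 show ?thesis by blast
    next
      case False
      \<comment> \<open>Here \<open>min k (n - k) = n - k\<close> if \<open>k \<le> n\<close>, so it is the
        family without \<open>n + 1\<close> that is settled first.\<close>
      have a0: "\<forall>J. J \<subseteq> {1..n} \<and> card J = Suc l \<longrightarrow> a J = \<zero>"
      proof (cases "k \<le> n")
        case True
        show ?thesis
          by (rule zero, rule low) (use False True in auto)
      next
        case False
        then show ?thesis
          using card_mono[of "{1..n}"] k by (metis (no_types) card_atLeastAtMost diff_Suc_1 finite_atLeastAtMost)
      qed
      then have S0: "S B = \<zero>" for B
        unfolding S_def by (intro add.finprod_one_eqI) auto
      have "\<forall>J. J \<subseteq> {1..n} \<and> card J = l \<longrightarrow> a' J = \<zero>"
      proof (rule zero')
        fix B assume "ballot_set n B" "card B \<le> min l (n - l)"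
        then have "S B \<oplus> S' B = \<zero>"
          using k by (intro plus) auto
        then show "S' B = \<zero>"
          using S' S0 by simp
      qed
      with a0 show ?thesis by blast
    qed
    have "J \<in> {J. J \<subseteq> {1..Suc n} - {} \<and> card J = Suc l}"
      using Suc.prems(3,4) k by simp
    then consider "J \<subseteq> {1..n}" "card J = Suc l"
      | K where "J = insert (Suc n) K" "K \<subseteq> {1..n}" "card K = l"
      unfolding ksubsets_Suc[OF empty_subsetI] by auto
    then show ?thesis
    proof cases
      case 1
      then show ?thesis
        using all_zero by simp
    next
      case 2
      then have "a' K = \<zero>"
        using all_zero by simp
      then show ?thesis
        by (simp add: a'_def 2(1))
    qed
  qed
qed

section \<open>Polynomial values and Vandermonde products\<close>

text \<open>
  The coefficients form a function on all of \<open>nat\<close>, so that inductions on \<open>n\<close> can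
  shift them.
\<close>

definition poly_value :: "('a, 'm) ring_scheme \<Rightarrow> nat \<Rightarrow> (nat \<Rightarrow> 'a) \<Rightarrow> 'a \<Rightarrow> 'a" where
  "poly_value S n d x = (\<Oplus>\<^bsub>S\<^esub>k\<in>{..<n}. d k \<otimes>\<^bsub>S\<^esub> x [^]\<^bsub>S\<^esub> k)"

definition difference_product :: "nat \<Rightarrow> ('a, 'm) ring_scheme \<Rightarrow> (nat \<Rightarrow> 'a) \<Rightarrow> 'a" where
  "difference_product n S x =
     finprod S (\<lambda>(j, k). x j \<ominus>\<^bsub>S\<^esub> x k) {(j, k). 1 \<le> j \<and> j < k \<and> k \<le> n}"

context cring
begin

lemma poly_value_closed [simp]:
  "(\<And>k. d k \<in> carrier R) \<Longrightarrow> x \<in> carrier R \<Longrightarrow> poly_value R n d x \<in> carrier R"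
  unfolding poly_value_def by (intro finsum_closed) auto

lemma poly_value_0 [simp]: "poly_value R 0 d x = \<zero>"
  by (simp add: poly_value_def)

lemma poly_value_Suc:
  assumes d: "\<And>k. d k \<in> carrier R" and x: "x \<in> carrier R"
  shows "poly_value R (Suc n) d x = d 0 \<oplus> x \<otimes> poly_value R n (\<lambda>k. d (Suc k)) x"
proof (induction n)
  case 0
  then show ?case
    using assms by (simp add: poly_value_def lessThan_Suc)
next
  case (Suc n)
  have step: "poly_value R (Suc m) e x = e m \<otimes> x [^] m \<oplus> poly_value R m e x"
    if "\<And>k. e k \<in> carrier R" for m e
    unfolding poly_value_def lessThan_Suc using that x by (subst finsum_insert) auto
  have "poly_value R (Suc (Suc n)) d x =
      d (Suc n) \<otimes> x [^] Suc n \<oplus> (d 0 \<oplus> x \<otimes> poly_value R n (\<lambda>k. d (Suc k)) x)"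
    using step[of d "Suc n"] d Suc.IH by simp
  also have "\<dots> = d 0 \<oplus> x \<otimes> (d (Suc n) \<otimes> x [^] n \<oplus> poly_value R n (\<lambda>k. d (Suc k)) x)"
    using d x by (simp add: r_distr m_ac a_ac)
  also have "d (Suc n) \<otimes> x [^] n \<oplus> poly_value R n (\<lambda>k. d (Suc k)) x =
      poly_value R (Suc n) (\<lambda>k. d (Suc k)) x"
    using step[of "\<lambda>k. d (Suc k)" n] d by simp
  finally show ?case .
qed

lemma poly_value_scale:
  assumes "\<And>k. d k \<in> carrier R" "x \<in> carrier R" "e \<in> carrier R"
  shows "poly_value R n (\<lambda>k. e \<otimes> d k) x = e \<otimes> poly_value R n d x"
  using assms unfolding poly_value_def
  by (subst finsum_rdistr) (auto simp: m_assoc intro!: finsum_cong)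

text \<open>
  Horner's scheme: the coefficients of the quotient by \<open>X - r\<close> are the values at \<open>r\<close>
  of the tails of the coefficient sequence.
\<close>

lemma synthetic_division:
  assumes d: "\<And>k. d k \<in> carrier R" and x: "x \<in> carrier R" and r: "r \<in> carrier R"
  shows "poly_value R (Suc n) d x =
    (x \<ominus> r) \<otimes> poly_value R n (\<lambda>k. poly_value R (n - k) (\<lambda>j. d (Suc (k + j))) r) x
      \<oplus> poly_value R (Suc n) d r"
  using d
proof (induction n arbitrary: d)
  case 0
  then show ?case
    using x r by (simp add: poly_value_Suc)
next
  case (Suc n)
  let ?d = "\<lambda>k. d (Suc k)"
  let ?h = "poly_value R n (\<lambda>k. poly_value R (n - k) (\<lambda>j. ?d (Suc (k + j))) r) x"
  let ?g = "poly_value R (Suc n) ?d r"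
  have carr: "d 0 \<in> carrier R" "?h \<in> carrier R" "?g \<in> carrier R"
    using Suc.prems x r by simp_all
  have regroup: "a \<oplus> x \<otimes> ((x \<ominus> r) \<otimes> h \<oplus> g) = (x \<ominus> r) \<otimes> (g \<oplus> x \<otimes> h) \<oplus> (a \<oplus> r \<otimes> g)"
    if "a \<in> carrier R" "h \<in> carrier R" "g \<in> carrier R" for a h g
    using that x r by algebra
  have quotient: "poly_value R (Suc n)
      (\<lambda>k. poly_value R (Suc n - k) (\<lambda>j. d (Suc (k + j))) r) x = ?g \<oplus> x \<otimes> ?h"
    using Suc.prems x r by (subst poly_value_Suc) simp_all
  have "poly_value R (Suc (Suc n)) d x = d 0 \<oplus> x \<otimes> ((x \<ominus> r) \<otimes> ?h \<oplus> ?g)"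
    using Suc.prems x Suc.IH[of ?d] by (subst poly_value_Suc) simp_all
  also have "\<dots> = (x \<ominus> r) \<otimes> (?g \<oplus> x \<otimes> ?h) \<oplus> (d 0 \<oplus> r \<otimes> ?g)"
    using regroup[OF carr] .
  also have "d 0 \<oplus> r \<otimes> ?g = poly_value R (Suc (Suc n)) d r"
    using Suc.prems r by (subst (2) poly_value_Suc) simp_all
  finally show ?case
    by (simp only: quotient)
qed

lemma difference_product_closed [simp]:
  "(\<And>i. i \<in> {1..n} \<Longrightarrow> x i \<in> carrier R) \<Longrightarrow> difference_product n R x \<in> carrier R"
  unfolding difference_product_def by (intro finprod_closed) auto

lemma finite_index_pairs: "finite {(j, k). 1 \<le> j \<and> j < k \<and> k \<le> (n::nat)}"
  by (rule finite_subset[of _ "{1..n} \<times> {1..n}"]) auto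

lemma difference_product_Suc:
  assumes x: "\<And>i. i \<in> {1..Suc n} \<Longrightarrow> x i \<in> carrier R"
  shows "difference_product (Suc n) R x =
    difference_product n R x \<otimes> (\<Otimes>i\<in>{1..n}. x i \<ominus> x (Suc n))"
proof -
  let ?P = "\<lambda>n. {(j, k). 1 \<le> j \<and> j < k \<and> k \<le> (n::nat)}"
  let ?g = "\<lambda>(j, k). x j \<ominus> x k"
  let ?N = "(\<lambda>j. (j, Suc n)) ` {1..n}"
  have split: "?P (Suc n) = ?P n \<union> ?N"
    by (auto simp: le_Suc_eq)
  have g: "?g \<in> ?P n \<rightarrow> carrier R" "?g \<in> ?N \<rightarrow> carrier R"
    using x by auto
  have "finprod R ?g (?P (Suc n)) = finprod R ?g (?P n) \<otimes> finprod R ?g ?N"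
    unfolding split by (rule finprod_Un_disjoint[OF finite_index_pairs _ _ g]) auto
  also have "finprod R ?g ?N = (\<Otimes>i\<in>{1..n}. x i \<ominus> x (Suc n))"
    by (subst finprod_reindex[OF g(2)]) (auto simp: inj_on_def)
  finally show ?thesis
    by (simp add: difference_product_def)
qed

text \<open>
  This is the divisibility that the adjugate of the Vandermonde matrix expresses, obtained by removing roots
  one at a time. With \<open>r\<close> the last root, the quotient by \<open>X - r\<close> vanishes at the
  other roots once it is multiplied by \<open>e = \<Prod>\<^sub>i (x i - r)\<close>, and the induction
  hypothesis applies to this multiple. By synthetic division the coefficients of the quotient are the values
  \<open>T (k + 1)\<close> of tails at \<open>r\<close>, and \<open>d k = T k - r T (k + 1)\<close>.
\<close>

lemma difference_product_kills_coefficients: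
  assumes "\<And>k. d k \<in> carrier R"
    and "\<And>i. i \<in> {1..n} \<Longrightarrow> x i \<in> carrier R"
    and "\<And>i. i \<in> {1..n} \<Longrightarrow> poly_value R n d (x i) = \<zero>"
    and "k < n"
  shows "difference_product n R x \<otimes> d k = \<zero>"
  using assms
proof (induction n arbitrary: d k)
  case 0
  then show ?case by simp
next
  case (Suc n)
  note d = Suc.prems(1) and x = Suc.prems(2) and root = Suc.prems(3)
  define r where "r = x (Suc n)"
  define e where "e = (\<Otimes>i\<in>{1..n}. x i \<ominus> r)"
  define T where "T k = poly_value R (Suc n - k) (\<lambda>j. d (k + j)) r" for k
  define V where "V = difference_product n R x"
  have r: "r \<in> carrier R"
    unfolding r_def using x by simp
  have e: "e \<in> carrier R"
    unfolding e_def using x r by (intro finprod_closed) auto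
  have T: "T k \<in> carrier R" for k
    unfolding T_def using d r by simp
  have V: "V \<in> carrier R"
    unfolding V_def by (rule difference_product_closed) (use x in auto)
  have V': "difference_product (Suc n) R x = V \<otimes> e"
    unfolding V_def e_def r_def using x by (rule difference_product_Suc)
  have quotient_root: "poly_value R n (\<lambda>k. e \<otimes> T (Suc k)) (x i) = \<zero>" if i: "i \<in> {1..n}" for i
  proof -
    have xi: "x i \<in> carrier R"
      using x i by simp
    let ?h = "poly_value R n (\<lambda>k. T (Suc k)) (x i)"
    let ?e = "\<Otimes>j\<in>{1..n} - {i}. x j \<ominus> r"
    have h: "?h \<in> carrier R" and e': "?e \<in> carrier R"
      using T xi x r by (auto intro!: finprod_closed)
    have "poly_value R (Suc n) d (x i) = (x i \<ominus> r) \<otimes> ?h \<oplus> poly_value R (Suc n) d r"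
      using synthetic_division[OF d xi r, of n] by (simp add: T_def)
    moreover have "poly_value R (Suc n) d (x i) = \<zero>" "poly_value R (Suc n) d r = \<zero>"
      using root i unfolding r_def by simp_all
    ultimately have 0: "(x i \<ominus> r) \<otimes> ?h = \<zero>"
      using xi r h by simp
    have "e = (\<Otimes>j\<in>insert i ({1..n} - {i}). x j \<ominus> r)"
      using i by (simp add: e_def insert_absorb)
    also have "\<dots> = (x i \<ominus> r) \<otimes> ?e"
      using x r xi by (subst finprod_insert) auto
    finally have "e \<otimes> ?h = ?e \<otimes> ((x i \<ominus> r) \<otimes> ?h)"
      using xi r h e' by (simp add: m_ac)
    then show ?thesis
      using T xi e e' by (simp add: poly_value_scale 0)
  qed
  have kills: "V \<otimes> e \<otimes> T k = \<zero>" for k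
  proof (cases k)
    case 0
    have "T 0 = \<zero>"
      using root[of "Suc n"] by (simp add: T_def r_def)
    then show ?thesis
      using 0 V e by simp
  next
    case (Suc l)
    show ?thesis
    proof (cases "l < n")
      case True
      have "V \<otimes> (e \<otimes> T (Suc l)) = \<zero>"
        unfolding V_def
        by (rule Suc.IH[of "\<lambda>k. e \<otimes> T (Suc k)"]) (use e T x quotient_root True in auto)
      then show ?thesis
        using Suc V e T by (simp add: m_assoc)
    next
      case False
      then have "T k = \<zero>"
        using Suc by (simp add: T_def)
      then show ?thesis
        using V e by simp
    qed
  qed
  have "T k = d k \<oplus> r \<otimes> T (Suc k)"
    using poly_value_Suc[of "\<lambda>j. d (k + j)" r "n - k"] d r Suc.prems(4)
    by (simp add: T_def Suc_diff_le less_Suc_eq_le)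
  then have "d k = T k \<ominus> r \<otimes> T (Suc k)"
    using d[of k] r T[of k] T[of "Suc k"] by algebra
  then have "V \<otimes> e \<otimes> d k = V \<otimes> e \<otimes> T k \<ominus> r \<otimes> (V \<otimes> e \<otimes> T (Suc k))"
    using V e r T[of k] T[of "Suc k"] by (simp add: mult_minus_distr m_ac)
  then show ?case
    using r by (simp add: V' kills r_right_minus_eq)
qed

lemma vandermonde_value_eq:
  "vandermonde_value n R x = (\<Otimes>j\<in>{1..n}. x j) \<otimes> difference_product n R x"
  by (simp add: vandermonde_value_def difference_product_def)

lemma vandermonde_value_closed:
  "x \<in> vecs n R \<Longrightarrow> vandermonde_value n R x \<in> carrier R"
  unfolding vandermonde_value_eq vecs_def
  by (intro m_closed finprod_closed difference_product_closed) auto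

lemma ideal_annihilator_element:
  assumes c: "c \<in> carrier R"
  shows "ideal {y \<in> carrier R. c \<otimes> y = \<zero>} R"
proof (rule idealI)
  show "subgroup {y \<in> carrier R. c \<otimes> y = \<zero>} (add_monoid R)"
    by (rule subgroup.intro) (use c in \<open>auto simp: r_distr r_minus a_inv_def[symmetric]\<close>)
  fix y r assume y: "y \<in> {y \<in> carrier R. c \<otimes> y = \<zero>}" and r: "r \<in> carrier R"
  then show "y \<otimes> r \<in> {y \<in> carrier R. c \<otimes> y = \<zero>}"
    using c by (simp add: m_assoc[symmetric])
  then show "r \<otimes> y \<in> {y \<in> carrier R. c \<otimes> y = \<zero>}"
    using y r by (simp add: m_comm)
qed (rule ring_axioms)

text \<open>
  The elements that a fixed \<open>c\<close> kills form an ideal, so it suffices to test the generators of the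
  Vandermonde ideal.
\<close>

lemma vandermonde_full_iff:
  "vandermonde_full n R \<longleftrightarrow>
    (\<forall>c\<in>carrier R. (\<forall>x\<in>vecs n R. c \<otimes> vandermonde_value n R x = \<zero>) \<longrightarrow> c = \<zero>)"
proof -
  let ?G = "vandermonde_value n R ` vecs n R"
  have G: "?G \<subseteq> carrier R"
    using vandermonde_value_closed by blast
  have gen: "(\<forall>y\<in>vandermonde_ideal n R. c \<otimes> y = \<zero>) \<longleftrightarrow> (\<forall>y\<in>?G. c \<otimes> y = \<zero>)"
    if c: "c \<in> carrier R" for c
    using genideal_self[OF G] genideal_minimal[OF ideal_annihilator_element[OF c], of ?G] G
    unfolding vandermonde_ideal_def by blast
  have ideal: "vandermonde_ideal n R \<subseteq> carrier R"
    unfolding vandermonde_ideal_def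
    by (meson G additive_subgroup.a_subset genideal_ideal ideal_def)
  have "\<zero> \<in> annihilator R (vandermonde_ideal n R)"
    using ideal by (auto simp: annihilator_def)
  then have "vandermonde_full n R \<longleftrightarrow> (\<forall>c\<in>annihilator R (vandermonde_ideal n R). c = \<zero>)"
    unfolding vandermonde_full_def by blast
  also have "\<dots> \<longleftrightarrow> (\<forall>c\<in>carrier R. (\<forall>y\<in>?G. c \<otimes> y = \<zero>) \<longrightarrow> c = \<zero>)"
    unfolding annihilator_def using gen by blast
  finally show ?thesis
    by blast
qed

text \<open>
  Evaluating at \<open>n\<close> points \<open>x j\<close> and multiplying by the product \<open>p\<close> of
  all points turns the hypothesis into \<open>n\<close> roots of the polynomial with coefficients
  \<open>p d k\<close>. So \<open>d k\<close> is killed by \<open>p\<close> times the difference product,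
  which is the Vandermonde value of \<open>x\<close>.
\<close>

lemma vandermonde_full_coefficients_zero:
  assumes full: "vandermonde_full n R"
    and d: "\<And>k. d k \<in> carrier R"
    and zero: "\<And>r. r \<in> carrier R \<Longrightarrow> r \<otimes> poly_value R n d r = \<zero>"
    and k: "k < n"
  shows "d k = \<zero>"
proof -
  have "d k \<otimes> vandermonde_value n R x = \<zero>" if "x \<in> vecs n R" for x
  proof -
    have x: "x i \<in> carrier R" if "i \<in> {1..n}" for i
      using \<open>x \<in> vecs n R\<close> that by (auto simp: vecs_def)
    define p where "p = (\<Otimes>j\<in>{1..n}. x j)"
    have p: "p \<in> carrier R"
      unfolding p_def using x by (intro finprod_closed) auto
    have "poly_value R n (\<lambda>k. p \<otimes> d k) (x i) = \<zero>" if i: "i \<in> {1..n}" for i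
    proof -
      let ?q = "\<Otimes>j\<in>{1..n} - {i}. x j"
      have q: "?q \<in> carrier R"
        using x by (intro finprod_closed) auto
      have "p = (\<Otimes>j\<in>insert i ({1..n} - {i}). x j)"
        using i by (simp add: p_def insert_absorb)
      also have "\<dots> = x i \<otimes> ?q"
        using x i by (subst finprod_insert) auto
      finally have "p \<otimes> poly_value R n d (x i) = ?q \<otimes> (x i \<otimes> poly_value R n d (x i))"
        using x[OF i] q d by (simp add: m_ac)
      then show ?thesis
        using x[OF i] q d p by (simp add: poly_value_scale zero)
    qed
    then have "difference_product n R x \<otimes> (p \<otimes> d k) = \<zero>"
      using p d x k by (intro difference_product_kills_coefficients) auto
    moreover have "difference_product n R x \<in> carrier R"
      using x by (rule difference_product_closed)
    ultimately show ?thesis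
      unfolding vandermonde_value_eq p_def[symmetric] using p d[of k] by (simp add: m_ac)
  qed
  then show ?thesis
    using full d by (simp add: vandermonde_full_iff)
qed

end

section \<open>Multi-affine maps along lines\<close>

context cring
begin

lemma finprod_zero_factor:
  assumes "finite A" "i \<in> A" "f i = \<zero>" "f \<in> A \<rightarrow> carrier R"
  shows "finprod R f A = \<zero>"
proof -
  have "finprod R f A = finprod R f (insert i (A - {i}))"
    using assms(2) by (simp add: insert_absorb)
  also have "\<dots> = f i \<otimes> finprod R f (A - {i})"
    using assms by (subst finprod_insert) auto
  also have "\<dots> = \<zero>"
    using assms by (simp add: Pi_def)
  finally show ?thesis .
qed

text \<open>
  Along a zero-one direction a multi-affine map is a polynomial in the scalar: only the subsets
  \<open>J\<close> of the support \<open>V\<close> contribute, each with \<open>r [^] card J\<close>.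
\<close>

lemma multi_affine_sum_on_line:
  assumes a: "a \<in> Pow {1..n} \<rightarrow> carrier R" and V: "V \<subseteq> {1..n}" and r: "r \<in> carrier R"
  shows "(\<Oplus>J\<in>Pow {1..n}. a J \<otimes> (\<Otimes>j\<in>J. if j \<in> V then r else \<zero>)) =
    poly_value R (Suc n) (\<lambda>k. finsum R a {J. J \<subseteq> V \<and> card J = k}) r"
proof -
  let ?C = "\<lambda>k. {J. J \<subseteq> V \<and> card J = k}"
  have fin: "finite V"
    using V finite_subset by blast
  have aC: "a \<in> ?C k \<rightarrow> carrier R" for k
    using a V by blast
  have aJ: "a J \<in> carrier R" if "J \<subseteq> {1..n}" for J
    using a that by blast
  have "(\<Oplus>J\<in>Pow {1..n}. a J \<otimes> (\<Otimes>j\<in>J. if j \<in> V then r else \<zero>)) =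
      (\<Oplus>J\<in>Pow V. a J \<otimes> r [^] card J)"
  proof (rule add.finprod_mono_neutral_cong_right)
    fix J assume J: "J \<in> Pow {1..n} - Pow V"
    then obtain i where "i \<in> J" "i \<notin> V" "finite J"
      using finite_subset by blast
    then have "(\<Otimes>j\<in>J. if j \<in> V then r else \<zero>) = \<zero>"
      using r by (intro finprod_zero_factor[of _ i]) auto
    then show "a J \<otimes> (\<Otimes>j\<in>J. if j \<in> V then r else \<zero>) = \<zero>"
      using aJ J by simp
  next
    fix J assume J: "J \<in> Pow V"
    then have "(\<Otimes>j\<in>J. if j \<in> V then r else \<zero>) = (\<Otimes>j\<in>J. r)"
      using r by (intro finprod_cong') auto
    then show "a J \<otimes> (\<Otimes>j\<in>J. if j \<in> V then r else \<zero>) = a J \<otimes> r [^] card J"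
      using r by (simp add: finprod_const)
  next
    show "(\<lambda>J. a J \<otimes> (\<Otimes>j\<in>J. if j \<in> V then r else \<zero>)) \<in> Pow {1..n} \<rightarrow> carrier R"
      using aJ r by (auto intro!: m_closed finprod_closed)
  qed (use V in auto)
  also have "Pow V = (\<Union>k\<in>{..<Suc n}. ?C k)"
    using V card_mono[OF _ subset_trans[OF _ V]] by (fastforce simp: less_Suc_eq_le)
  also have "(\<Oplus>J\<in>(\<Union>k\<in>{..<Suc n}. ?C k). a J \<otimes> r [^] card J) =
      (\<Oplus>k\<in>{..<Suc n}. \<Oplus>J\<in>?C k. a J \<otimes> r [^] card J)"
    by (rule add.finprod_UN_disjoint)
       (use fin r aC in \<open>auto simp: pairwise_def disjnt_def Pi_def\<close>)
  also have "\<dots> = poly_value R (Suc n) (\<lambda>k. finsum R a (?C k)) r"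
    unfolding poly_value_def
  proof (rule finsum_cong')
    fix k
    have "(\<Oplus>J\<in>?C k. a J \<otimes> r [^] card J) = (\<Oplus>J\<in>?C k. a J \<otimes> r [^] k)"
      using aC[of k] r by (intro finsum_cong') auto
    also have "\<dots> = finsum R a (?C k) \<otimes> r [^] k"
      by (rule finsum_ldistr[symmetric]) (use fin r aC in auto)
    finally show "(\<Oplus>J\<in>?C k. a J \<otimes> r [^] card J) = finsum R a (?C k) \<otimes> r [^] k" .
  qed (use aC r in \<open>auto intro!: m_closed finsum_closed\<close>)
  finally show ?thesis .
qed

lemma multi_affine_sum_degree_le_1:
  fixes n :: nat
  assumes a: "a \<in> Pow {1..n} \<rightarrow> carrier R"
    and zero: "\<And>J. J \<subseteq> {1..n} \<Longrightarrow> 2 \<le> card J \<Longrightarrow> a J = \<zero>"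
    and c: "\<And>i. i \<in> {1..n} \<Longrightarrow> c i \<in> carrier R"
  shows "(\<Oplus>J\<in>Pow {1..n}. a J \<otimes> (\<Otimes>j\<in>J. c j)) = a {} \<oplus> (\<Oplus>i\<in>{1..n}. a {i} \<otimes> c i)"
proof -
  have c': "c \<in> J \<rightarrow> carrier R" if "J \<subseteq> {1..n}" for J
    using c that by blast
  have aJ: "a J \<in> carrier R" if "J \<subseteq> {1..n}" for J
    using a that by blast
  let ?t = "\<lambda>J. a J \<otimes> (\<Otimes>j\<in>J. c j)"
  let ?S = "(\<lambda>i. {i}) ` {1..n}"
  have t: "?t J \<in> carrier R" if "J \<subseteq> {1..n}" for J
    using aJ[OF that] c'[OF that] by simp
  have "finsum R ?t (Pow {1..n}) = finsum R ?t (insert {} ?S)"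
  proof (rule add.finprod_mono_neutral_cong_right)
    fix J assume J: "J \<in> Pow {1..n} - insert {} ?S"
    then have fin: "finite J"
      using finite_subset[of J "{1..n}"] by auto
    have "card J \<noteq> 0"
      using J fin by auto
    moreover have "card J \<noteq> 1"
      using J by (auto simp: card_1_singleton_iff)
    ultimately have "a J = \<zero>"
      using J by (intro zero) auto
    then show "?t J = \<zero>"
      using c'[of J] J by simp
  qed (use t in auto)
  also have "\<dots> = ?t {} \<oplus> finsum R ?t ?S"
    by (rule finsum_insert) (use t aJ in auto)
  also have "finsum R ?t ?S = (\<Oplus>i\<in>{1..n}. ?t {i})"
    by (rule finsum_reindex) (use aJ c in \<open>auto simp: inj_on_def\<close>)
  also have "\<dots> = (\<Oplus>i\<in>{1..n}. a {i} \<otimes> c i)"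
    using aJ c by (intro finsum_cong') auto
  finally show ?thesis
    using aJ[of "{}"] by simp
qed

text \<open>
  Along the line of a ballot set \<open>B\<close>, the coefficient of \<open>r\<^sup>k\<close> is the sum of
  \<open>a J\<close> over the \<open>k\<close>-subsets \<open>J\<close> that are disjoint from
  \<open>B\<close>. Affine-linearity and Vandermonde fullness make it vanish for \<open>k \<ge> 2\<close>, and
  these sums determine all \<open>a J\<close> with \<open>card J \<ge> 2\<close>.
\<close>

theorem vandermonde_full_detects_affine_linear:
  assumes nontrivial: "\<one> \<noteq> \<zero>" and n: "n \<noteq> 0" and full: "vandermonde_full n R"
  shows "detects_affine_linear n R (ballot_directions n R)"
  unfolding detects_affine_linear_def
proof (intro ballI impI, elim conjE)
  fix f assume f: "f \<in> vecs n R \<rightarrow> carrier R" and "multi_affine n R f"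
    and lines: "\<forall>v\<in>ballot_directions n R. affine_linear_along n R f v"
  then obtain a where a: "a \<in> Pow {1..n} \<rightarrow> carrier R"
    and fa: "\<And>x. x \<in> vecs n R \<Longrightarrow> f x = (\<Oplus>J\<in>Pow {1..n}. a J \<otimes> (\<Otimes>j\<in>J. x j))"
    unfolding multi_affine_def by blast
  have aJ: "a J \<in> carrier R" if "J \<subseteq> {1..n}" for J
    using a that by blast
  have zero_vec: "zero_vector n R \<in> vecs n R"
    by (simp add: zero_vector_def vecs_def)
  have layer: "finsum R a {J. J \<subseteq> {1..n} - B \<and> card J = k} = \<zero>"
    if B: "ballot_set n B" and k: "2 \<le> k" "k \<le> n" for B k
  proof -
    define V where "V = {1..n} - B"
    define c where "c k = finsum R a {J. J \<subseteq> V \<and> card J = k}" for k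
    define v where "v = (\<lambda>j\<in>{1..n}. if j \<in> V then \<one> else \<zero>)"
    have V: "V \<subseteq> {1..n}"
      by (auto simp: V_def)
    have c: "c k \<in> carrier R" for k
      unfolding c_def using aJ V by (intro finsum_closed) auto
    have "v \<in> ballot_directions n R"
      unfolding ballot_directions_def using B nontrivial
      by (auto simp: v_def V_def intro!: exI[of _ B])
    then obtain m where m: "m \<in> carrier R" and line: "\<And>r. r \<in> carrier R \<Longrightarrow>
        f (scale_vector n R r v) = f (zero_vector n R) \<oplus> r \<otimes> m"
      using lines unfolding affine_linear_along_def by blast
    have on_line: "f (scale_vector n R r v) = c 0 \<oplus> r \<otimes> poly_value R n (\<lambda>k. c (Suc k)) r"
      if r: "r \<in> carrier R" for r
    proof -
      have "scale_vector n R r v \<in> vecs n R"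
        using r by (auto simp: scale_vector_def vecs_def v_def)
      then have "f (scale_vector n R r v) =
          (\<Oplus>J\<in>Pow {1..n}. a J \<otimes> (\<Otimes>j\<in>J. scale_vector n R r v j))"
        by (rule fa)
      also have "\<dots> = (\<Oplus>J\<in>Pow {1..n}. a J \<otimes> (\<Otimes>j\<in>J. if j \<in> V then r else \<zero>))"
      proof (rule finsum_cong')
        fix J assume J: "J \<in> Pow {1..n}"
        have "(\<Otimes>j\<in>J. scale_vector n R r v j) = (\<Otimes>j\<in>J. if j \<in> V then r else \<zero>)"
          using J r by (intro finprod_cong') (auto simp: scale_vector_def v_def)
        then show "a J \<otimes> (\<Otimes>j\<in>J. scale_vector n R r v j) =
            a J \<otimes> (\<Otimes>j\<in>J. if j \<in> V then r else \<zero>)"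
          by simp
      qed (use aJ r in \<open>auto intro!: m_closed finprod_closed\<close>)
      also have "\<dots> = poly_value R (Suc n) c r"
        unfolding c_def by (rule multi_affine_sum_on_line[OF a V r])
      also have "\<dots> = c 0 \<oplus> r \<otimes> poly_value R n (\<lambda>k. c (Suc k)) r"
        using c r by (rule poly_value_Suc)
      finally show ?thesis .
    qed
    have f0: "f (zero_vector n R) \<in> carrier R"
      using f zero_vec by blast
    \<comment> \<open>Taking \<open>r = 0\<close> identifies the constant term.\<close>
    have c0: "f (zero_vector n R) = c 0"
      using on_line[of \<zero>] line[of \<zero>] c m f0 by simp
    have eq: "r \<otimes> poly_value R n (\<lambda>k. c (Suc k)) r = r \<otimes> m" if r: "r \<in> carrier R" for r
    proof -
      let ?p = "poly_value R n (\<lambda>k. c (Suc k)) r"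
      have "c 0 \<oplus> r \<otimes> ?p = c 0 \<oplus> r \<otimes> m"
        using on_line[OF r] line[OF r] c0 by simp
      then show ?thesis
        by (rule add.l_cancel) (use c m r in simp_all)
    qed
    \<comment> \<open>The slope \<open>m\<close> is absorbed into the linear coefficient, so that the values
      \<open>r \<otimes> poly_value R n d r\<close> all vanish; index \<open>k\<close> of \<open>d\<close>
      belongs to degree \<open>k + 1\<close>.\<close>
    define d where "d k = (if k = 0 then c 1 \<ominus> m else c (Suc k))" for k
    have d: "d k \<in> carrier R" for k
      using c m by (simp add: d_def)
    obtain n' where n': "n = Suc n'"
      using n not0_implies_Suc by blast
    have "r \<otimes> poly_value R n d r = \<zero>" if r: "r \<in> carrier R" for r
    proof -
      let ?q = "poly_value R n' (\<lambda>k. c (Suc (Suc k))) r"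
      have q: "?q \<in> carrier R"
        using c r by simp
      have shifted: "poly_value R n d r = (c 1 \<ominus> m) \<oplus> r \<otimes> ?q"
        unfolding n' using d r by (subst poly_value_Suc) (simp_all add: d_def)
      have "poly_value R n (\<lambda>k. c (Suc k)) r = c 1 \<oplus> r \<otimes> ?q"
        unfolding n' using c r by (subst poly_value_Suc) simp_all
      with eq[OF r] have line_slope: "r \<otimes> (c 1 \<oplus> r \<otimes> ?q) = r \<otimes> m"
        by simp
      have "r \<otimes> ((x \<ominus> m) \<oplus> r \<otimes> y) = r \<otimes> (x \<oplus> r \<otimes> y) \<ominus> r \<otimes> m"
        if "x \<in> carrier R" "y \<in> carrier R" for x y
        using that r m by algebra
      then have "r \<otimes> poly_value R n d r = r \<otimes> (c 1 \<oplus> r \<otimes> ?q) \<ominus> r \<otimes> m"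
        unfolding shifted using c q by blast
      then show ?thesis
        unfolding line_slope using r m by (simp add: r_right_minus_eq)
    qed
    from vandermonde_full_coefficients_zero[OF full d this, of "k - 1"]
    show ?thesis
      using k by (simp add: d_def c_def V_def)
  qed
  have high: "a J = \<zero>" if J: "J \<subseteq> {1..n}" "2 \<le> card J" for J
  proof -
    have "card J \<le> n"
      using card_mono[OF _ J(1)] by simp
    then show ?thesis
      using aJ layer J
      by (intro ballot_sums_determine[where n = n and k = "card J" and a = a]) auto
  qed
  note affine = multi_affine_sum_degree_le_1[OF a high]
  have f_eq: "f c = a {} \<oplus> (\<Oplus>i\<in>{1..n}. a {i} \<otimes> c i)" if "c \<in> vecs n R" for c
    unfolding fa[OF that] by (rule affine) (use that in \<open>auto simp: vecs_def\<close>)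
  have "(\<Oplus>i\<in>{1..n}. a {i} \<otimes> zero_vector n R i) = \<zero>"
    by (rule add.finprod_one_eqI) (use aJ in \<open>auto simp: zero_vector_def\<close>)
  then have "f (zero_vector n R) = a {}"
    using f_eq[OF zero_vec] aJ[of "{}"] by simp
  then show "affine_linear n R f"
    unfolding affine_linear_def using f_eq aJ by (intro bexI[of _ "\<lambda>i. a {i}"]) auto
qed

text \<open>
  The map \<open>f x = b x\<^sub>1 \<cdots> x\<^sub>q\<close> satisfies
  \<open>f (r v) = r\<^sup>q f v = r f v\<close>, so it is linear on every line through the origin. It is not
  affine-linear: it vanishes on the unit vectors because \<open>q \<ge> 2\<close>, yet its value at the
  all-ones vector is \<open>b\<close>.
\<close>

theorem not_detects_affine_linear:
  assumes b: "b \<in> carrier R" "b \<noteq> \<zero>" and q: "2 \<le> q" "q \<le> n"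
    and pow: "\<And>r. r \<in> carrier R \<Longrightarrow> b \<otimes> r [^] q = b \<otimes> r"
  shows "\<not> detects_affine_linear n R (vecs n R)"
proof
  assume detects: "detects_affine_linear n R (vecs n R)"
  define f where "f x = b \<otimes> (\<Otimes>j\<in>{1..q}. x j)" for x :: "nat \<Rightarrow> 'a"
  have sub: "{1..q} \<subseteq> {1..n}"
    using q by auto
  have vec: "x j \<in> carrier R" if "x \<in> vecs n R" "j \<in> {1..n}" for x j
    using that by (auto simp: vecs_def)
  have vec_prod: "(\<Otimes>j\<in>{1..q}. x j) \<in> carrier R" if "x \<in> vecs n R" for x
    using vec[OF that] sub by (intro finprod_closed) blast
  have f_closed: "f \<in> vecs n R \<rightarrow> carrier R"
    unfolding f_def using vec_prod b by auto
  have f_zero: "f x = \<zero>" if "x \<in> vecs n R" "i \<in> {1..q}" "x i = \<zero>" for x i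
  proof -
    have "(\<Otimes>j\<in>{1..q}. x j) = \<zero>"
      by (rule finprod_zero_factor[of _ i]) (use that vec sub in auto)
    then show ?thesis
      using b by (simp add: f_def)
  qed
  have zero_vec: "zero_vector n R \<in> vecs n R"
    by (simp add: zero_vector_def vecs_def)
  have f0: "f (zero_vector n R) = \<zero>"
    by (rule f_zero[OF zero_vec, of 1]) (use q in \<open>auto simp: zero_vector_def\<close>)
  have "multi_affine n R f"
    unfolding multi_affine_def
  proof (intro bexI[of _ "\<lambda>J. if J = {1..q} then b else \<zero>"] ballI)
    fix x assume x: "x \<in> vecs n R"
    have P: "(\<Otimes>j\<in>J. x j) \<in> carrier R" if "J \<subseteq> {1..n}" for J
      using vec[OF x] that by (intro finprod_closed) blast
    have "(\<Oplus>J\<in>Pow {1..n}. (if J = {1..q} then b else \<zero>) \<otimes> (\<Otimes>j\<in>J. x j)) =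
        (\<Oplus>J\<in>{{1..q}}. b \<otimes> (\<Otimes>j\<in>J. x j))"
      by (rule add.finprod_mono_neutral_cong_right) (use P b sub in auto)
    then show "f x = (\<Oplus>J\<in>Pow {1..n}. (if J = {1..q} then b else \<zero>) \<otimes> (\<Otimes>j\<in>J. x j))"
      using b P[OF sub] by (simp add: f_def)
  qed (use b in auto)
  moreover have "affine_linear_along n R f v" if v: "v \<in> vecs n R" for v
    unfolding affine_linear_along_def
  proof (intro bexI ballI)
    fix r assume r: "r \<in> carrier R"
    have "(\<Otimes>j\<in>{1..q}. scale_vector n R r v j) = (\<Otimes>j\<in>{1..q}. r \<otimes> v j)"
      using sub r vec[OF v] by (intro finprod_cong') (auto simp: scale_vector_def)
    also have "\<dots> = (\<Otimes>j\<in>{1..q}. r) \<otimes> (\<Otimes>j\<in>{1..q}. v j)"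
      by (rule finprod_multf) (use r vec[OF v] sub in auto)
    also have "(\<Otimes>j\<in>{1..q}. r) = r [^] q"
      using r by (simp add: finprod_const)
    finally have "f (scale_vector n R r v) = (b \<otimes> r [^] q) \<otimes> (\<Otimes>j\<in>{1..q}. v j)"
      using b r vec_prod[OF v] by (simp add: f_def m_assoc)
    also have "\<dots> = r \<otimes> f v"
      using b r vec_prod[OF v] by (simp add: pow f_def m_ac)
    finally show "f (scale_vector n R r v) = f (zero_vector n R) \<oplus> r \<otimes> f v"
      using r funcset_mem[OF f_closed v] by (simp add: f0)
  qed (rule funcset_mem[OF f_closed v])
  ultimately have "affine_linear n R f"
    using detects f_closed unfolding detects_affine_linear_def by blast
  then obtain a where a: "\<And>i. i \<in> {1..n} \<Longrightarrow> a i \<in> carrier R"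
    and fa: "\<And>c. c \<in> vecs n R \<Longrightarrow> f c = (\<Oplus>i\<in>{1..n}. a i \<otimes> c i)"
  proof -
    assume that: "\<And>a. (\<And>i. i \<in> {1..n} \<Longrightarrow> a i \<in> carrier R) \<Longrightarrow>
      (\<And>c. c \<in> vecs n R \<Longrightarrow> f c = (\<Oplus>i\<in>{1..n}. a i \<otimes> c i)) \<Longrightarrow> thesis"
    assume "affine_linear n R f"
    then obtain a where a: "a \<in> {1..n} \<rightarrow> carrier R"
      and fa: "\<And>c. c \<in> vecs n R \<Longrightarrow> f c = f (zero_vector n R) \<oplus> (\<Oplus>i\<in>{1..n}. a i \<otimes> c i)"
      unfolding affine_linear_def by blast
    show thesis
    proof (rule that)
      fix c assume c: "c \<in> vecs n R"
      have "(\<Oplus>i\<in>{1..n}. a i \<otimes> c i) \<in> carrier R"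
        using a vec[OF c] by (intro finsum_closed) auto
      then show "f c = (\<Oplus>i\<in>{1..n}. a i \<otimes> c i)"
        using fa[OF c] f0 by simp
    qed (use a in auto)
  qed
  have a0: "a i = \<zero>" if i: "i \<in> {1..n}" for i
  proof -
    define u where "u = (\<lambda>j\<in>{1..n}. if i = j then \<one> else \<zero>)"
    have u: "u \<in> vecs n R"
      by (auto simp: u_def vecs_def)
    have "\<exists>j\<in>{1..q}. j \<noteq> i"
      using q by (intro bexI[of _ "if i = 1 then 2 else 1"]) auto
    then obtain j where "j \<in> {1..q}" "j \<noteq> i"
      by blast
    then have "f u = \<zero>"
      using sub by (intro f_zero[OF u, of j]) (auto simp: u_def)
    moreover have "(\<Oplus>j\<in>{1..n}. a j \<otimes> u j) = (\<Oplus>j\<in>{1..n}. if i = j then a j else \<zero>)"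
      using a by (intro finsum_cong') (auto simp: u_def)
    moreover have "\<dots> = a i"
      using i a by (intro finsum_singleton) auto
    ultimately show ?thesis
      using fa[OF u] by simp
  qed
  define w where "w = (\<lambda>j\<in>{1..n}. \<one>)"
  have w: "w \<in> vecs n R"
    by (simp add: w_def vecs_def)
  have "(\<Otimes>j\<in>{1..q}. w j) = \<one>"
    by (rule finprod_one_eqI) (use sub in \<open>auto simp: w_def\<close>)
  then have "f w = b"
    using b by (simp add: f_def)
  moreover have "(\<Oplus>i\<in>{1..n}. a i \<otimes> w i) = \<zero>"
    by (rule add.finprod_one_eqI) (simp add: a0 w_def)
  ultimately show False
    using fa[OF w] b by simp
qed

end

section \<open>Residue rings of prime ideals\<close>

lemma (in cring) exists_maximalideal_containing:
  assumes A: "ideal A R" and one: "\<one> \<notin> A"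
  shows "\<exists>\<mm>. maximalideal \<mm> R \<and> A \<subseteq> \<mm>"
proof -
  let ?S = "{J. ideal J R \<and> A \<subseteq> J \<and> \<one> \<notin> J}"
  have "\<exists>M\<in>?S. \<forall>J\<in>?S. M \<subseteq> J \<longrightarrow> J = M"
  proof (rule subset_Zorn_nonempty)
    show "?S \<noteq> {}"
      using A one by blast
    fix C assume C: "C \<noteq> {}" "subset.chain ?S C"
    then have "subset.chain {J. ideal J R} C"
      unfolding subset_chain_def by blast
    then have "ideal (\<Union>C) R"
      using chain_Union_is_ideal[of C] C(1) by simp
    moreover have "C \<subseteq> ?S"
      using C(2) unfolding subset_chain_def by blast
    ultimately show "\<Union>C \<in> ?S"
      using C(1) by blast
  qed
  then obtain M where "M \<in> ?S" and max_S: "\<forall>J\<in>?S. M \<subseteq> J \<longrightarrow> J = M"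
    by (elim bexE)
  then have M: "ideal M R" "A \<subseteq> M" "\<one> \<notin> M"
    by simp_all
  have max: "J = M" if "ideal J R" "\<one> \<notin> J" "M \<subseteq> J" for J
    using max_S that subset_trans[OF M(2) that(3)] by simp
  have "maximalideal M R"
  proof (rule maximalidealI[OF M(1)])
    show "carrier R \<noteq> M"
      using M(3) by blast
    show "J = M \<or> J = carrier R" if "ideal J R" "M \<subseteq> J" for J
      using max[OF that(1) _ that(2)] ideal.one_imp_carrier[OF that(1)] by blast
  qed
  then show ?thesis
    using M(2) by blast
qed

text \<open>
  A finite domain is a field with \<open>q\<close> elements, whose \<open>q - 1\<close> nonzero elements form
  a group.
\<close>

lemma (in domain) finite_power_card_eq_self:
  assumes fin: "finite (carrier R)" and r: "r \<in> carrier R"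
  shows "r [^] card (carrier R) = r"
proof -
  have units: "Units R = carrier R - {\<zero>}"
  proof (intro equalityI subsetI)
    fix x assume x: "x \<in> carrier R - {\<zero>}"
    have "inj_on (\<lambda>y. x \<otimes> y) (carrier R)"
      using x by (intro inj_onI) (auto simp: m_lcancel)
    then have "(\<lambda>y. x \<otimes> y) ` carrier R = carrier R"
      using x by (intro endo_inj_surj[OF fin]) auto
    then obtain y where "y \<in> carrier R" "\<one> = x \<otimes> y"
      by (metis (no_types, lifting) imageE one_closed)
    then show "x \<in> Units R"
      using x by (auto simp: Units_def m_comm intro!: bexI[of _ y])
  qed (use zero_not_one in \<open>auto simp: Units_def\<close>)
  have card: "card (carrier R) = Suc (card (Units R))"
    unfolding units using fin by (metis card_Suc_Diff1 zero_closed)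
  show ?thesis
  proof (cases "r = \<zero>")
    case True
    then show ?thesis
      by (simp add: card)
  next
    case False
    then have "r \<in> Units R"
      using r units by blast
    then have "r [^] card (Units R) = \<one>"
      using units_power_order_eq_one fin units by simp
    then show ?thesis
      using r by (simp add: card)
  qed
qed

lemma (in domain) finprod_nonzero:
  assumes "finite A" "f \<in> A \<rightarrow> carrier R" "\<And>a. a \<in> A \<Longrightarrow> f a \<noteq> \<zero>"
  shows "finprod R f A \<noteq> \<zero>"
  using assms by (induction A) (auto simp: integral_iff Pi_def)

lemma (in domain) vandermonde_value_nonzero:
  assumes x: "x \<in> vecs n R" "inj_on x {1..n}" "\<zero> \<notin> x ` {1..n}"
  shows "vandermonde_value n R x \<noteq> \<zero>"
proof -
  have carr: "x j \<in> carrier R" if "j \<in> {1..n}" for j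
    using x(1) that by (auto simp: vecs_def)
  have diff: "x j \<ominus> x k \<in> carrier R" "x j \<ominus> x k \<noteq> \<zero>"
    if "1 \<le> j" "j < k" "k \<le> n" for j k
    using carr[of j] carr[of k] that inj_onD[OF x(2), of j k] by (auto simp: r_right_minus_eq)
  have 1: "(\<Otimes>j\<in>{1..n}. x j) \<noteq> \<zero>"
    by (rule finprod_nonzero) (use carr x(3) in force)+
  have 2: "difference_product n R x \<noteq> \<zero>"
    unfolding difference_product_def
    by (rule finprod_nonzero[OF finite_index_pairs]) (use diff in auto)
  have "(\<Otimes>j\<in>{1..n}. x j) \<in> carrier R"
    using carr by (intro finprod_closed) auto
  moreover have "difference_product n R x \<in> carrier R"
    using carr by (rule difference_product_closed)
  ultimately show ?thesis
    unfolding vandermonde_value_eq using 1 2 by (simp add: integral_iff)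
qed

lemma (in ring_hom_cring) hom_minus:
  "x \<in> carrier R \<Longrightarrow> y \<in> carrier R \<Longrightarrow> h (x \<ominus> y) = h x \<ominus>\<^bsub>S\<^esub> h y"
  by (simp add: a_minus_def)

lemma (in ring_hom_cring) hom_vandermonde_value:
  assumes x: "x \<in> vecs n R" and y: "\<And>j. j \<in> {1..n} \<Longrightarrow> h (x j) = y j"
  shows "h (vandermonde_value n R x) = vandermonde_value n S y"
proof -
  have carr: "x j \<in> carrier R" if "j \<in> {1..n}" for j
    using x that by (auto simp: vecs_def)
  have y_carr: "y j \<in> carrier S" if "j \<in> {1..n}" for j
    using y[OF that] carr[OF that] by (metis hom_closed)
  have prod: "h (\<Otimes>j\<in>{1..n}. x j) = (\<Otimes>\<^bsub>S\<^esub>j\<in>{1..n}. y j)"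
    by (subst hom_finprod) (use carr y y_carr in \<open>auto intro!: S.finprod_cong'\<close>)
  have diff: "h (x j \<ominus> x k) = y j \<ominus>\<^bsub>S\<^esub> y k" if "j \<in> {1..n}" "k \<in> {1..n}" for j k
    using carr[OF that(1)] carr[OF that(2)] y[OF that(1)] y[OF that(2)] by (simp only: hom_minus)
  have "h (difference_product n R x) = difference_product n S y"
    unfolding difference_product_def
    by (subst hom_finprod) (use carr diff y_carr in \<open>auto intro!: S.finprod_cong'\<close>)
  moreover have "(\<Otimes>j\<in>{1..n}. x j) \<in> carrier R" "difference_product n R x \<in> carrier R"
    using carr by (auto intro!: R.finprod_closed R.difference_product_closed)
  ultimately show ?thesis
    using prod by (simp only: R.vandermonde_value_eq S.vandermonde_value_eq hom_mult)
qed

lemma enat_less_ecard_imp_subset: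
  assumes "enat n < ecard A"
  shows "\<exists>T\<subseteq>A. finite T \<and> card T = Suc n"
proof (cases "finite A")
  case True
  then show ?thesis
    using assms obtain_subset_with_card_n[of "Suc n" A] finite_subset
    by (metis Suc_leI ecard_def enat_ord_simps(2))
next
  case False
  then show ?thesis
    using infinite_arbitrarily_large by blast
qed

lemma carrier_FactRing: "carrier (R Quot P) = (\<lambda>a. P +>\<^bsub>R\<^esub> a) ` carrier R"
  unfolding FactRing_def A_RCOSETS_def' by auto

lemma zero_FactRing: "\<zero>\<^bsub>R Quot P\<^esub> = P"
  by (simp add: FactRing_def)

text \<open>
  A domain with more than \<open>n\<close> elements has \<open>n\<close> distinct nonzero ones;
  representatives of these form a vector whose Vandermonde value is nonzero modulo \<open>P\<close>.
\<close>

lemma (in cring) vandermonde_value_notin_prime: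
  assumes P: "primeideal P R" and n: "enat n < ecard (carrier (R Quot P))"
  shows "\<exists>x\<in>vecs n R. vandermonde_value n R x \<notin> P"
proof -
  let ?D = "R Quot P"
  interpret P: primeideal P R by fact
  interpret D: domain ?D by (rule P.quotient_is_domain)
  interpret h: ring_hom_cring R ?D "(+>) P" by (rule P.rcos_ring_hom_cring)
  obtain T where T: "T \<subseteq> carrier ?D" "finite T" "card T = Suc n"
    using enat_less_ecard_imp_subset[OF n] by blast
  have "n \<le> card (T - {\<zero>\<^bsub>?D\<^esub>})"
    using T(2,3) by (cases "\<zero>\<^bsub>?D\<^esub> \<in> T") simp_all
  then have "\<exists>y. y ` {1..n} \<subseteq> T - {\<zero>\<^bsub>?D\<^esub>} \<and> inj_on y {1..n}"
    using T(2) by (intro card_le_inj) simp_all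
  then obtain y where y: "y ` {1..n} \<subseteq> T - {\<zero>\<^bsub>?D\<^esub>}" "inj_on y {1..n}"
    by blast
  define z where "z = (\<lambda>j\<in>{1..n}. y j)"
  have yj: "y j \<in> carrier ?D" "y j \<noteq> \<zero>\<^bsub>?D\<^esub>" if "j \<in> {1..n}" for j
  proof -
    have "y j \<in> T - {\<zero>\<^bsub>?D\<^esub>}"
      using y(1) that by blast
    then show "y j \<in> carrier ?D" "y j \<noteq> \<zero>\<^bsub>?D\<^esub>"
      using T(1) by blast+
  qed
  have z: "z \<in> vecs n ?D" "inj_on z {1..n}" "\<zero>\<^bsub>?D\<^esub> \<notin> z ` {1..n}"
  proof -
    show "z \<in> vecs n ?D"
      unfolding z_def vecs_def using yj(1) by (intro restrict_PiE_iff[THEN iffD2]) blast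
    show "inj_on z {1..n}"
      unfolding z_def inj_on_restrict_eq by (rule y(2))
    show "\<zero>\<^bsub>?D\<^esub> \<notin> z ` {1..n}"
      unfolding z_def image_restrict_eq using y(1) by blast
  qed
  have "\<exists>a\<in>carrier R. P +> a = z j" if "j \<in> {1..n}" for j
  proof -
    have "z j \<in> carrier ?D"
      using yj(1)[OF that] that by (simp add: z_def)
    then show ?thesis
      unfolding carrier_FactRing by (metis imageE)
  qed
  then obtain a where a: "\<And>j. j \<in> {1..n} \<Longrightarrow> a j \<in> carrier R \<and> P +> a j = z j"
    by metis
  define x where "x = (\<lambda>j\<in>{1..n}. a j)"
  have x: "x \<in> vecs n R"
    using a by (simp add: x_def vecs_def)
  have "P +> vandermonde_value n R x = vandermonde_value n ?D z"
    by (rule h.hom_vandermonde_value[OF x]) (use a in \<open>simp add: x_def\<close>)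
  moreover have "vandermonde_value n ?D z \<noteq> P"
    using D.vandermonde_value_nonzero[OF z] unfolding zero_FactRing .
  ultimately have "vandermonde_value n R x \<notin> P"
    using P.a_rcos_const by metis
  with x show ?thesis by blast
qed

lemma (in cring) power_residue_card:
  assumes P: "primeideal P R" and fin: "finite (carrier (R Quot P))" and r: "r \<in> carrier R"
  shows "r [^] card (carrier (R Quot P)) \<ominus> r \<in> P"
proof -
  let ?D = "R Quot P"
  interpret P: primeideal P R by fact
  interpret D: domain ?D by (rule P.quotient_is_domain)
  interpret h: ring_hom_cring R ?D "(+>) P" by (rule P.rcos_ring_hom_cring)
  let ?q = "card (carrier ?D)"
  have "P +> r [^] ?q = (P +> r) [^]\<^bsub>?D\<^esub> ?q"
    using r by (rule h.ring.hom_nat_pow)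
  also have "\<dots> = P +> r"
    using D.finite_power_card_eq_self[OF fin] r by simp
  finally have "P +> (r [^] ?q \<ominus> r) = (P +> r) \<ominus>\<^bsub>?D\<^esub> (P +> r)"
    using h.hom_minus[OF _ r, of "r [^] ?q"] r by simp
  moreover have "(P +> r) \<ominus>\<^bsub>?D\<^esub> (P +> r) = P"
    using D.r_right_minus_eq[OF h.hom_closed[OF r] h.hom_closed[OF r]]
    unfolding zero_FactRing by blast
  moreover have "r [^] ?q \<ominus> r \<in> P +> (r [^] ?q \<ominus> r)"
    using r by (intro P.a_rcos_self) simp
  ultimately show ?thesis
    by (simp only:)
qed

section \<open>Contracted maximal ideals of the total ring of fractions\<close>

lemma (in cring) primeideal_contraction:
  assumes "\<one> \<noteq> \<zero>" and m: "maximalideal \<mm> (total_fractions R)"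
  shows "primeideal (contraction R \<mm>) R"
proof -
  interpret Q: cring "total_fractions R"
    by (rule cring_total_fractions[OF assms(1)])
  interpret h: ring_hom_ring R "total_fractions R" "to_total_fractions R"
    by (rule ring_hom_ringI2[OF ring_axioms Q.ring_axioms to_total_fractions_hom[OF assms(1)]])
  show ?thesis
    unfolding contraction_def
    by (rule h.primeideal_vimage[OF is_cring Q.maximalideal_prime[OF m]])
qed

text \<open>
  The image of \<open>a\<close> in the total ring of fractions is nonzero, so its annihilator there is a
  proper ideal and lies in a maximal one.
\<close>

lemma (in cring) exists_contraction_containing_annihilator:
  assumes nontrivial: "\<one> \<noteq> \<zero>" and a: "a \<in> carrier R" "a \<noteq> \<zero>"
  shows "\<exists>\<mm>\<in>max_spec (total_fractions R). {y \<in> carrier R. a \<otimes> y = \<zero>} \<subseteq> contraction R \<mm>"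
proof -
  let ?Q = "total_fractions R" and ?h = "to_total_fractions R"
  interpret Q: cring ?Q
    by (rule cring_total_fractions[OF nontrivial])
  interpret h: ring_hom_cring R ?Q ?h
    by unfold_locales (rule to_total_fractions_hom[OF nontrivial])
  let ?A = "{y \<in> carrier ?Q. ?h a \<otimes>\<^bsub>?Q\<^esub> y = \<zero>\<^bsub>?Q\<^esub>}"
  have "?h a \<noteq> ?h \<zero>"
    using inj_onD[OF inj_on_to_total_fractions[OF nontrivial]] a by blast
  then have "?h a \<noteq> \<zero>\<^bsub>?Q\<^esub>"
    by simp
  then have "\<one>\<^bsub>?Q\<^esub> \<notin> ?A"
    using a by simp
  moreover have "ideal ?A ?Q"
    using a by (intro Q.ideal_annihilator_element) simp
  ultimately obtain \<mm> where m: "maximalideal \<mm> ?Q" "?A \<subseteq> \<mm>"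
    using Q.exists_maximalideal_containing by blast
  have "?h y \<in> ?A" if "y \<in> carrier R" "a \<otimes> y = \<zero>" for y
    using that a h.hom_mult[of a y] by simp
  then have "{y \<in> carrier R. a \<otimes> y = \<zero>} \<subseteq> contraction R \<mm>"
    using m(2) unfolding contraction_def by blast
  then show ?thesis
    using m(1) by (auto simp: max_spec_def)
qed

text \<open>
  The numerator of a nonzero fraction annihilating \<open>\<mm>\<close> annihilates the contraction of
  \<open>\<mm>\<close>, since denominators are regular.
\<close>

lemma (in cring) kasch_contraction_annihilated:
  assumes nontrivial: "\<one> \<noteq> \<zero>" and kasch: "kasch (total_fractions R)"
    and m: "\<mm> \<in> max_spec (total_fractions R)"
  shows "\<exists>b\<in>carrier R. b \<noteq> \<zero> \<and> (\<forall>c\<in>contraction R \<mm>. b \<otimes> c = \<zero>)"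
proof -
  let ?Q = "total_fractions R" and ?M = "carrier R - zero_divisors R"
  interpret Q: cring ?Q
    by (rule cring_total_fractions[OF nontrivial])
  have M: "submonoid ?M R"
    by (rule submonoid_regular[OF nontrivial])
  have one: "\<one> \<in> ?M"
    by (rule submonoid.one_closed[OF M])
  have regular: "x = \<zero>" if "u \<in> ?M" "x \<in> carrier R" "u \<otimes> x = \<zero>" for u x
    using that by (auto simp: zero_divisors_def)
  have "\<mm> \<subseteq> carrier ?Q"
    using m by (auto simp: max_spec_def maximalideal_def ideal_def dest: additive_subgroup.a_subset)
  then have "\<zero>\<^bsub>?Q\<^esub> \<in> annihilator ?Q \<mm>"
    by (auto simp: annihilator_def)
  moreover have "annihilator ?Q \<mm> \<noteq> {\<zero>\<^bsub>?Q\<^esub>}"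
    using kasch m by (simp add: kasch_def)
  ultimately obtain w where w: "w \<in> annihilator ?Q \<mm>" "w \<noteq> \<zero>\<^bsub>?Q\<^esub>"
    by blast
  then have "w \<in> carrier (localization ?M R)"
    by (simp add: annihilator_def total_fractions_def)
  then obtain b s where bs: "w = fraction ?M R b s" "b \<in> carrier R" "s \<in> ?M"
    unfolding carrier_localization by blast
  have s: "s \<in> carrier R"
    using bs(3) by simp
  have "fraction ?M R \<zero> s = \<zero>\<^bsub>?Q\<^esub>"
    unfolding total_fractions_def zero_localization
    using s by (intro fraction_eqI[OF M _ bs(3) _ one]) simp_all
  then have "b \<noteq> \<zero>"
    using w(2) bs(1) by auto
  moreover have "b \<otimes> c = \<zero>" if c: "c \<in> contraction R \<mm>" for c
  proof -
    have c: "c \<in> carrier R" "fraction ?M R c \<one> \<in> \<mm>"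
      using c by (auto simp: contraction_def to_total_fractions_def)
    have "fraction ?M R (b \<otimes> c) (s \<otimes> \<one>) = w \<otimes>\<^bsub>?Q\<^esub> fraction ?M R c \<one>"
      unfolding bs(1) total_fractions_def using bs(2,3) c(1) one
      by (simp add: mult_localization[OF M])
    also have "\<dots> = fraction ?M R \<zero> \<one>"
      using w(1) c(2) by (simp add: annihilator_def) (simp add: total_fractions_def zero_localization)
    finally obtain u where "u \<in> ?M" "u \<otimes> (b \<otimes> c \<otimes> \<one> \<ominus> \<zero> \<otimes> (s \<otimes> \<one>)) = \<zero>"
      using bs(2,3) c(1) one s by (subst (asm) fraction_eq_iff[OF M]) auto
    moreover have "b \<otimes> c \<otimes> \<one> \<ominus> \<zero> \<otimes> (s \<otimes> \<one>) = b \<otimes> c"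
      using bs(2) c(1) s by (simp add: a_minus_def)
    ultimately show ?thesis
      using regular bs(2) c(1) by simp
  qed
  ultimately show ?thesis
    using bs(2) by blast
qed

section \<open>Products of rings\<close>

definition single :: "'i set \<Rightarrow> ('i \<Rightarrow> ('a, 'm) ring_scheme) \<Rightarrow> 'i \<Rightarrow> 'a \<Rightarrow> 'i \<Rightarrow> 'a" where
  "single I R i b = (\<lambda>k\<in>I. if k = i then b else \<zero>\<^bsub>R k\<^esub>)"

locale crings_product =
  fixes I :: "'i set" and R :: "'i \<Rightarrow> ('a, 'm) ring_scheme"
  assumes factor_cring: "\<And>i. i \<in> I \<Longrightarrow> cring (R i)"
begin

abbreviation "RR \<equiv> product_ring I R"

lemma cring_RR: "cring RR"
  using factor_cring by (rule cring_product_ring)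

lemma projection_hom:
  assumes i: "i \<in> I"
  shows "ring_hom_cring RR (R i) (\<lambda>x. x i)"
proof -
  have "(\<lambda>x. x i) \<in> ring_hom RR (R i)"
    using i by (auto simp: product_ring_def ring_hom_def)
  then show ?thesis
    using cring_RR factor_cring[OF i] by (simp add: ring_hom_cring_def ring_hom_cring_axioms_def)
qed

lemma product_eqI:
  assumes "x \<in> carrier RR" "y \<in> carrier RR" "\<And>i. i \<in> I \<Longrightarrow> x i = y i"
  shows "x = y"
  using assms by (auto simp: product_ring_def intro: PiE_ext)

lemma single_closed: "i \<in> I \<Longrightarrow> b \<in> carrier (R i) \<Longrightarrow> single I R i b \<in> carrier RR"
  using cring.cring_simprules(2)[OF factor_cring] by (auto simp: single_def product_ring_def)

text \<open>
  Let \<open>c\<close> have a nonzero component \<open>c i\<close>. The annihilator of \<open>c i\<close> lies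
  in a contracted maximal ideal, whose residue ring has more than \<open>n\<close> elements. So some
  Vandermonde value in \<open>R i\<close> avoids this ideal, and \<open>c i\<close> does not kill it.
\<close>

lemma vandermonde_full_product:
  assumes nontrivial: "\<And>i. i \<in> I \<Longrightarrow> \<one>\<^bsub>R i\<^esub> \<noteq> \<zero>\<^bsub>R i\<^esub>" and tau: "enat n < tau I R"
  shows "vandermonde_full n RR"
proof -
  interpret RR: cring RR by (rule cring_RR)
  show ?thesis
    unfolding RR.vandermonde_full_iff
  proof (intro ballI impI, rule ccontr)
    fix c assume c: "c \<in> carrier RR" "c \<noteq> \<zero>\<^bsub>RR\<^esub>"
      and kills: "\<forall>x\<in>vecs n RR. c \<otimes>\<^bsub>RR\<^esub> vandermonde_value n RR x = \<zero>\<^bsub>RR\<^esub>"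
    then obtain i where i: "i \<in> I" and "c i \<noteq> \<zero>\<^bsub>RR\<^esub> i"
      using product_eqI[OF c(1) RR.zero_closed] by blast
    interpret Ri: cring "R i" using factor_cring[OF i] .
    interpret pr: ring_hom_cring RR "R i" "\<lambda>x. x i" by (rule projection_hom[OF i])
    have ci: "c i \<in> carrier (R i)" "c i \<noteq> \<zero>\<^bsub>R i\<^esub>"
      using c(1) \<open>c i \<noteq> \<zero>\<^bsub>RR\<^esub> i\<close> by simp_all
    obtain \<mm> where m: "\<mm> \<in> max_spec (total_fractions (R i))"
      and ann: "{y \<in> carrier (R i). c i \<otimes>\<^bsub>R i\<^esub> y = \<zero>\<^bsub>R i\<^esub>} \<subseteq> contraction (R i) \<mm>"
      using Ri.exists_contraction_containing_annihilator[OF nontrivial[OF i] ci] by blast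
    have "tau I R \<le> ecard (carrier (R i Quot contraction (R i) \<mm>))"
      unfolding tau_def using i m by (meson INF_lower2 INF_lower)
    then have "enat n < ecard (carrier (R i Quot contraction (R i) \<mm>))"
      using tau by (rule less_le_trans[rotated])
    moreover have "primeideal (contraction (R i) \<mm>) (R i)"
      using m by (intro Ri.primeideal_contraction nontrivial[OF i]) (simp add: max_spec_def)
    ultimately obtain x where x: "x \<in> vecs n (R i)"
      and notin: "vandermonde_value n (R i) x \<notin> contraction (R i) \<mm>"
      using Ri.vandermonde_value_notin_prime by blast
    \<comment> \<open>Only component \<open>i\<close> of the test vector matters; the others are zero.\<close>
    define y where "y = (\<lambda>j\<in>{1..n}. single I R i (x j))"
    have y: "y \<in> vecs n RR"
      using x i by (auto simp: y_def vecs_def intro!: single_closed)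
    have "vandermonde_value n RR y i = vandermonde_value n (R i) x"
      by (rule pr.hom_vandermonde_value[OF y]) (use i in \<open>simp add: y_def single_def\<close>)
    moreover have "c i \<otimes>\<^bsub>R i\<^esub> vandermonde_value n RR y i = \<zero>\<^bsub>R i\<^esub>"
      using kills y c(1) RR.vandermonde_value_closed[OF y]
      by (metis pr.hom_mult pr.hom_zero)
    ultimately show False
      using ann notin Ri.vandermonde_value_closed[OF x] by auto
  qed
qed

text \<open>
  The infimum defining \<open>\<tau>\<close> is attained at a residue ring with \<open>q \<le> n\<close>
  elements, and there \<open>r\<^sup>q - r\<close> lies in the contracted ideal \<open>P\<close>. By the Kasch
  property some nonzero \<open>b\<close> kills \<open>P\<close>. Then \<open>b r\<^sup>q = b r\<close> in
  \<open>R i\<close>, and also in the product after extending \<open>b\<close> by zero.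
\<close>

lemma not_detects_affine_linear_product:
  assumes nontrivial: "\<And>i. i \<in> I \<Longrightarrow> \<one>\<^bsub>R i\<^esub> \<noteq> \<zero>\<^bsub>R i\<^esub>"
    and kasch: "\<And>i. i \<in> I \<Longrightarrow> kasch (total_fractions (R i))"
    and tau: "tau I R \<le> enat n"
  shows "\<not> detects_affine_linear n RR (vecs n RR)"
proof -
  interpret RR: cring RR by (rule cring_RR)
  have "tau I R < enat (Suc n)"
    using tau by (rule le_less_trans) simp
  then obtain i \<mm> where i: "i \<in> I" and m: "\<mm> \<in> max_spec (total_fractions (R i))"
    and "ecard (carrier (R i Quot contraction (R i) \<mm>)) < enat (Suc n)"
    unfolding tau_def INF_less_iff by blast
  then have fin: "finite (carrier (R i Quot contraction (R i) \<mm>))"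
    and le: "card (carrier (R i Quot contraction (R i) \<mm>)) \<le> n"
    by (auto simp: ecard_def split: if_splits)
  let ?P = "contraction (R i) \<mm>"
  let ?q = "card (carrier (R i Quot ?P))"
  interpret Ri: cring "R i" using factor_cring[OF i] .
  interpret pr: ring_hom_cring RR "R i" "\<lambda>x. x i" by (rule projection_hom[OF i])
  have P: "primeideal ?P (R i)"
    using m by (intro Ri.primeideal_contraction nontrivial[OF i]) (simp add: max_spec_def)
  interpret D: domain "R i Quot ?P" by (rule primeideal.quotient_is_domain[OF P])
  have "card {\<zero>\<^bsub>R i Quot ?P\<^esub>, \<one>\<^bsub>R i Quot ?P\<^esub>} \<le> ?q"
    by (rule card_mono[OF fin]) simp
  then have q: "2 \<le> ?q"
    using D.zero_not_one by simp
  obtain b where b: "b \<in> carrier (R i)" "b \<noteq> \<zero>\<^bsub>R i\<^esub>"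
    and kill: "\<And>c. c \<in> ?P \<Longrightarrow> b \<otimes>\<^bsub>R i\<^esub> c = \<zero>\<^bsub>R i\<^esub>"
    using Ri.kasch_contraction_annihilated[OF nontrivial[OF i] kasch[OF i] m] by blast
  show ?thesis
  proof (rule RR.not_detects_affine_linear[OF _ _ q le])
    show closed: "single I R i b \<in> carrier RR"
      using i b(1) by (rule single_closed)
    have "single I R i b i \<noteq> \<zero>\<^bsub>RR\<^esub> i"
      using b(2) i by (simp add: single_def)
    then show "single I R i b \<noteq> \<zero>\<^bsub>RR\<^esub>"
      by metis
    fix r assume r: "r \<in> carrier RR"
    show "single I R i b \<otimes>\<^bsub>RR\<^esub> r [^]\<^bsub>RR\<^esub> ?q = single I R i b \<otimes>\<^bsub>RR\<^esub> r"
    proof (rule product_eqI)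
      fix k assume k: "k \<in> I"
      interpret Rk: cring "R k" using factor_cring[OF k] .
      interpret pk: ring_hom_cring RR "R k" "\<lambda>x. x k" by (rule projection_hom[OF k])
      show "(single I R i b \<otimes>\<^bsub>RR\<^esub> r [^]\<^bsub>RR\<^esub> ?q) k = (single I R i b \<otimes>\<^bsub>RR\<^esub> r) k"
      proof (cases "k = i")
        case True
        have ri: "r i \<in> carrier (R i)"
          using r by (rule pr.hom_closed)
        have pow: "(r [^]\<^bsub>RR\<^esub> ?q) i = r i [^]\<^bsub>R i\<^esub> ?q"
          using r by (rule pr.ring.hom_nat_pow)
        have "b \<otimes>\<^bsub>R i\<^esub> (r i [^]\<^bsub>R i\<^esub> ?q) \<ominus>\<^bsub>R i\<^esub> b \<otimes>\<^bsub>R i\<^esub> r i = \<zero>\<^bsub>R i\<^esub>"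
          using kill[OF Ri.power_residue_card[OF P fin ri]] b(1) ri by (simp add: Ri.mult_minus_distr)
        then have "b \<otimes>\<^bsub>R i\<^esub> (r i [^]\<^bsub>R i\<^esub> ?q) = b \<otimes>\<^bsub>R i\<^esub> r i"
          using b(1) ri by (simp add: Ri.r_right_minus_eq)
        then show ?thesis
          using True i closed r pow by (simp add: single_def)
      next
        case False
        then have "single I R i b k = \<zero>\<^bsub>R k\<^esub>"
          using k by (simp add: single_def)
        then show ?thesis
          using closed r by simp
      qed
    qed (use closed r in simp_all)
  qed
qed

end

section \<open>Equivalence of fullness, residue ring sizes and affine-linearity tests\<close>

theorem theorem3:
  fixes I :: "'i set" and R :: "'i \<Rightarrow> ('a, 'm) ring_scheme" and n :: nat
  assumes "I \<noteq> {}"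
    and "\<And>i. i \<in> I \<Longrightarrow> cring (R i)"
    and "\<And>i. i \<in> I \<Longrightarrow> \<one>\<^bsub>R i\<^esub> \<noteq> \<zero>\<^bsub>R i\<^esub>"
    and "\<And>i. i \<in> I \<Longrightarrow> kasch (total_fractions (R i))"
    and "n \<ge> 3"
  shows "(vandermonde_full n (product_ring I R) \<longleftrightarrow> tau I R > enat n) \<and>
         (tau I R > enat n \<longleftrightarrow>
            detects_affine_linear n (product_ring I R) (vecs n (product_ring I R))) \<and>
         (detects_affine_linear n (product_ring I R) (vecs n (product_ring I R)) \<longleftrightarrow>
            detects_affine_linear n (product_ring I R) (ballot_directions n (product_ring I R)))"
proof -
  interpret crings_product I R
    using assms(2) by (rule crings_product.intro)
  interpret RR: cring RR by (rule cring_RR)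
  obtain i where i: "i \<in> I"
    using assms(1) by blast
  interpret pr: ring_hom_cring RR "R i" "\<lambda>x. x i" by (rule projection_hom[OF i])
  have nontrivial: "\<one>\<^bsub>RR\<^esub> \<noteq> \<zero>\<^bsub>RR\<^esub>"
    using assms(3)[OF i] pr.hom_one pr.hom_zero by metis
  have "detects_affine_linear n RR (ballot_directions n RR)" if "vandermonde_full n RR"
    using assms(5) that
    by (intro RR.vandermonde_full_detects_affine_linear[OF nontrivial]) simp_all
  moreover have "(\<Pi>\<^sub>E j\<in>{1..n}. {\<zero>\<^bsub>RR\<^esub>, \<one>\<^bsub>RR\<^esub>}) \<subseteq> vecs n RR"
    unfolding vecs_def by (rule PiE_mono) simp
  then have "ballot_directions n RR \<subseteq> vecs n RR"
    unfolding ballot_directions_def by blast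
  then have "detects_affine_linear n RR (vecs n RR)"
    if "detects_affine_linear n RR (ballot_directions n RR)"
    using that unfolding detects_affine_linear_def by blast
  moreover have "enat n < tau I R" if "detects_affine_linear n RR (vecs n RR)"
    using not_detects_affine_linear_product[of n] assms(3,4) that not_le by blast
  moreover have "vandermonde_full n RR" if "enat n < tau I R"
    using assms(3) that by (rule vandermonde_full_product)
  ultimately show ?thesis
    by blast
qed

end
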